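(* There is an algorithm that, given an arbitrary digraph $D$ on $n$ vertices and a positive integer $k$, decides in time $2^{O(k\log^2 k)}\cdot n^{O(1)}$ whether $D$ contains an out-tree with at least $k$ leaves (the problem $k$-DMLOT). For acyclic digraphs $D$, this can be decided in time $2^{O(k\log k)}\cdot n^{O(1)}$.
   Context: Digraphs are finite, without loops and without parallel arcs (directed 2-cycles are allowed). A subdigraph $T$ of $D$ is an out-tree if $T$ is an oriented tree (its underlying undirected graph is a tree) with exactly one vertex of in-degree zero in $T$, called the root; an out-tree need not be spanning. The leaves of $T$ are the vertices of out-degree zero in $T$. The parameterized problem $k$-DMLOT (Directed Maximum Leaf Out-Tree) is: given a digraph $D$ and a positive integer parameter $k$, does $D$ contain an out-tree with at least $k$ leaves? *)

theory Defs
  imports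
    "Graph_Theory.Graph_Theory"
    "HOL-Library.Landau_Symbols"
begin

section \<open>Out-trees\<close>

text \<open>
  The predicate \<^const>\<open>tree\<close> of the graph library only excludes directed cycles, so an acyclic
  orientation of a triangle is a \<^const>\<open>tree\<close>.  Here the underlying undirected graph has to be
  a tree.  In \<^const>\<open>mk_symmetric\<close> every undirected edge yields a closed walk of length 2,
  therefore undirected cycles are the library cycles of length at least 3.
\<close>

definition oriented_tree :: "('a, 'b) pre_digraph \<Rightarrow> bool" where
  "oriented_tree T \<longleftrightarrow>
     digraph T \<and>
     (\<forall>u v. (u, v) \<in> arcs_ends T \<longrightarrow> (v, u) \<notin> arcs_ends T) \<and>
     Digraph_Component.connected T \<and>
     \<not> (\<exists>p. pre_digraph.cycle (with_proj (mk_symmetric T)) p \<and> 3 \<le> length p)"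

definition out_tree :: "('a, 'b) pre_digraph \<Rightarrow> bool" where
  "out_tree T \<longleftrightarrow> oriented_tree T \<and> (\<exists>!r. r \<in> verts T \<and> in_degree T r = 0)"

definition leaves :: "('a, 'b) pre_digraph \<Rightarrow> 'a set" where
  "leaves T = {v \<in> verts T. out_degree T v = 0}"

definition has_out_tree_with_leaves :: "('a, 'b) pre_digraph \<Rightarrow> nat \<Rightarrow> bool" where
  "has_out_tree_with_leaves D k \<longleftrightarrow>
     (\<exists>T. subgraph T D \<and> out_tree T \<and> k \<le> card (leaves T))"

definition acyclic_digraph :: "('a, 'b) pre_digraph \<Rightarrow> bool" where
  "acyclic_digraph D \<longleftrightarrow> \<not> (\<exists>p. pre_digraph.cycle D p)"


section \<open>Algorithms and running time\<close>

text \<open>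
  Algorithms are structured programs for a random access machine.  The memory consists of named
  arrays of natural numbers; the cell with index 0 of an array serves as a scalar variable, and a
  program mentions only finitely many names.  The only arithmetic operations are addition and
  truncated subtraction, each at unit cost: since there is no multiplication, the bit length of
  a number grows by at most one per time unit, so running times agree with those of Turing
  machines up to a polynomial.
\<close>

type_synonym memory = "string \<Rightarrow> nat \<Rightarrow> nat"

datatype expr =
    Num nat
  | Cell string expr
  | Plus expr expr
  | Minus expr expr

primrec eval_expr :: "expr \<Rightarrow> memory \<Rightarrow> nat" where
  "eval_expr (Num m) s = m"
| "eval_expr (Cell x e) s = s x (eval_expr e s)"
| "eval_expr (Plus e1 e2) s = eval_expr e1 s + eval_expr e2 s"
| "eval_expr (Minus e1 e2) s = eval_expr e1 s - eval_expr e2 s"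

primrec expr_cost :: "expr \<Rightarrow> nat" where
  "expr_cost (Num m) = 1"
| "expr_cost (Cell x e) = 1 + expr_cost e"
| "expr_cost (Plus e1 e2) = 1 + expr_cost e1 + expr_cost e2"
| "expr_cost (Minus e1 e2) = 1 + expr_cost e1 + expr_cost e2"

datatype program =
    Skip
  | Assign string expr expr
  | Seq program program
  | Cond expr program program
  | While expr program

text \<open>
  In \<open>Assign x i e\<close> the value of \<open>e\<close> is stored in cell \<open>i\<close> of the array \<open>x\<close>.  A guard counts as
  true iff its value is not 0.  \<open>exec c s t s'\<close>: started in memory \<open>s\<close>, the program \<open>c\<close> terminates
  after exactly \<open>t\<close> time units in memory \<open>s'\<close>.
\<close>

inductive exec :: "program \<Rightarrow> memory \<Rightarrow> nat \<Rightarrow> memory \<Rightarrow> bool" where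
  Skip: "exec Skip s 1 s"
| Assign: "exec (Assign x i e) s (1 + expr_cost i + expr_cost e)
             (s(x := (s x)(eval_expr i s := eval_expr e s)))"
| Seq: "exec c1 s t1 s' \<Longrightarrow> exec c2 s' t2 s'' \<Longrightarrow> exec (Seq c1 c2) s (t1 + t2) s''"
| CondTrue: "eval_expr b s \<noteq> 0 \<Longrightarrow> exec c1 s t s' \<Longrightarrow>
             exec (Cond b c1 c2) s (1 + expr_cost b + t) s'"
| CondFalse: "eval_expr b s = 0 \<Longrightarrow> exec c2 s t s' \<Longrightarrow>
              exec (Cond b c1 c2) s (1 + expr_cost b + t) s'"
| WhileFalse: "eval_expr b s = 0 \<Longrightarrow> exec (While b c) s (1 + expr_cost b) s"
| WhileTrue: "eval_expr b s \<noteq> 0 \<Longrightarrow> exec c s t1 s' \<Longrightarrow> exec (While b c) s' t2 s'' \<Longrightarrow>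
              exec (While b c) s (1 + expr_cost b + t1 + t2) s''"

inductive_cases SkipE: "exec Skip s t s'"
inductive_cases AssignE: "exec (Assign x i e) s t s'"
inductive_cases SeqE: "exec (Seq c1 c2) s t s'"
inductive_cases CondE: "exec (Cond b c1 c2) s t s'"
inductive_cases WhileE: "exec (While b c) s t s'"

lemma exec_deterministic:
  assumes "exec c s t s'" and "exec c s u s''"
  shows "u = t \<and> s'' = s'"
  using assms
proof (induction arbitrary: u s'' rule: exec.induct)
  case (Skip s)
  then show ?case by (auto elim: SkipE)
next
  case (Assign x i s e)
  then show ?case by (auto elim: AssignE)
next
  case (Seq c1 s t1 s1 c2 t2 s2)
  from Seq.prems show ?case
  proof (rule SeqE)
    fix r1 r s3
    assume "u = r1 + r" "exec c1 s r1 s3" "exec c2 s3 r s''"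
    then show ?thesis using Seq.IH by fastforce
  qed
next
  case (CondTrue b s c1 t s' c2)
  from CondTrue.prems show ?case
  proof (rule CondE)
    fix r assume "u = Suc (expr_cost b + r)" "exec c1 s r s''"
    then show ?thesis using CondTrue.IH by fastforce
  qed (use CondTrue.hyps in simp)
next
  case (CondFalse b s c2 t s' c1)
  from CondFalse.prems show ?case
  proof (rule CondE)
    fix r assume "u = Suc (expr_cost b + r)" "exec c2 s r s''"
    then show ?thesis using CondFalse.IH by fastforce
  qed (use CondFalse.hyps in simp)
next
  case (WhileFalse b s c)
  from WhileFalse.prems show ?case
    by (rule WhileE) (use WhileFalse.hyps in simp_all)
next
  case (WhileTrue b s c t1 s1 t2 s2)
  from WhileTrue.prems show ?case
  proof (rule WhileE)
    fix r1 r s3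
    assume "u = Suc (expr_cost b + r1 + r)" "exec c s r1 s3" "exec (While b c) s3 r s''"
    then show ?thesis using WhileTrue.IH by fastforce
  qed (use WhileTrue.hyps in simp)
qed


section \<open>The problem k-DMLOT\<close>

text \<open>
  The input is the number of vertices, the parameter and the adjacency matrix (row by row) of the
  digraph with respect to an enumeration \<open>vs\<close> of its vertices; all other cells are 0.
\<close>

definition dmlot_input :: "nat pair_pre_digraph \<Rightarrow> nat list \<Rightarrow> nat \<Rightarrow> memory" where
  "dmlot_input D vs k = (\<lambda>x i.
     if x = ''n'' \<and> i = 0 then length vs
     else if x = ''k'' \<and> i = 0 then k
     else if x = ''adj'' \<and>
       (\<exists>a b. a < length vs \<and> b < length vs \<and> i = a * length vs + b \<and> (vs ! a, vs ! b) \<in> parcs D)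
     then 1
     else 0)"

definition decides_dmlot_within :: "program \<Rightarrow> nat pair_pre_digraph \<Rightarrow> nat \<Rightarrow> real \<Rightarrow> bool" where
  "decides_dmlot_within c D k bound \<longleftrightarrow>
     (\<forall>vs. distinct vs \<and> set vs = pverts D \<longrightarrow>
        (\<exists>t s'. exec c (dmlot_input D vs k) t s' \<and> real t \<le> bound \<and>
           (s' ''out'' 0 \<noteq> 0 \<longleftrightarrow> has_out_tree_with_leaves (with_proj D) k)))"

end

theory Submission
  imports Defs "HOL-Real_Asymp.Real_Asymp"
begin

text \<open>
  One branching algorithm with \<open>4 ^ k\<close> branches (Kneis, Langer and Rossmanith) gives both time bounds.
  Apart from single-vertex trees, an out-tree with at least \<open>k\<close> leaves exists iff some set \<open>I\<close> of
  vertices, all reachable from a root through \<open>I\<close>, has at least \<open>k\<close> out-neighbours outside \<open>I\<close>.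
  Grow \<open>I\<close> from a guessed root: for an undecided out-neighbour \<open>u\<close> of \<open>I\<close>, one bit decides whether
  \<open>u\<close> stays outside for ever (it becomes red) or joins \<open>I\<close>; in the latter case, as long as the vertex that
  joined last contributes exactly one new out-neighbour, this one joins too.  If the target \<open>J\<close>
  has the least cardinality among all solutions for the root, then a vertex of \<open>J\<close> whose only new
  out-neighbour (if any) is outside \<open>J\<close> could be dropped from \<open>J\<close>; so following \<open>J\<close> never stops at
  such a vertex, and every bit raises the number of red vertices or of boundary vertices.
  Red vertices are boundary vertices, hence \<open>2 * k\<close> bits suffice.
\<close>

section \<open>Out-trees and rooted vertex sets\<close>

text \<open>The target \<open>J\<close> belongs to the analysis only. Every bit string ends in a
  rooted set whose coloured boundary is its true boundary, so a run that reaches \<open>k\<close>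
  boundary vertices is itself a witness; minimality of \<open>J\<close> shows that some bit string
  gets that far. The potential is \<open>card (red c) + card (fringe c)\<close>. A vertex that joins
  leaves the boundary, so a single new out-neighbour would merely keep the boundary size; letting
  that neighbour join within the same bit is what makes the potential rise. If all
  \<open>2 * k\<close> bits are spent, the potential is at least \<open>2 * k\<close>, and the
  fringe accounts for at least half of it. Programs have neither recursion nor multiplication.
  Therefore the branching tree becomes a loop over all numbers below \<open>4 ^ k\<close>, each
  replayed from the root, and matrix offsets and powers of two come from tables filled by addition.
  The cost is \<open>4 ^ k\<close> times a polynomial in \<open>k\<close> and \<open>n\<close>, so
  the exponent is linear in \<open>k\<close>.\<close>

definition rooted :: "('a \<times> 'a) set \<Rightarrow> 'a \<Rightarrow> 'a set \<Rightarrow> bool" where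
  "rooted E r I \<longleftrightarrow> r \<in> I \<and> I \<subseteq> (E \<inter> I \<times> UNIV)\<^sup>* `` {r}"

definition boundary :: "('a \<times> 'a) set \<Rightarrow> 'a set \<Rightarrow> 'a set" where
  "boundary E I = E `` I - I"

section \<open>From out-trees to rooted sets\<close>

lemma cycle_imp_cycle_mk_symmetric:
  assumes "pre_digraph.cycle T p"
  shows "pre_digraph.cycle (with_proj (mk_symmetric T)) (map (arc_to_ends T) p)"
proof -
  interpret pre_digraph T .
  \<comment> \<open>Walks and their vertex lists depend only on the ends of the arcs, so replacing
    each arc by its pair of ends keeps a cycle a cycle of the same length. This moves directed
    cycles into the graph where \<open>oriented_tree\<close> forbids them.\<close>
  have cas: "pcas u (map (arc_to_ends T) q) v \<longleftrightarrow> cas u q v" for u q v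
    by (induction q arbitrary: u) (auto simp: arc_to_ends_def)
  have verts: "pawalk_verts u (map (arc_to_ends T) q) = awalk_verts u q" for u q
    by (induction q arbitrary: u) (auto simp: arc_to_ends_def)
  have "arc_to_ends T ` arcs T \<subseteq> parcs (mk_symmetric T)"
    by (auto simp: mk_symmetric_def arcs_ends_def arc_to_ends_def)
  then show ?thesis
    using assms unfolding pre_digraph.cycle_def pre_digraph.awalk_def
    by (auto 0 4 simp: cas verts cas_with_proj_eq awalk_verts_with_proj_eq)
qed

text \<open>A directed cycle of length at least 3 survives in the symmetric closure, where it is
  forbidden; one of length 2 is a pair of opposite arcs, and one of length 1 is a loop.\<close>

lemma oriented_tree_acyclic:
  assumes "oriented_tree T"
  shows "acyclic (arcs_ends T)"
proof (rule acyclicI, safe)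
  interpret digraph T using assms by (simp add: oriented_tree_def)
  fix v assume "(v, v) \<in> (arcs_ends T)\<^sup>+"
  then obtain w where "awalk v w v" "w \<noteq> []"
    using reachable1_awalk by blast
  then have "closed_w w" by (auto simp: closed_w_def)
  then obtain p where p: "cycle p" using closed_w_imp_cycle by blast
  then have "length p < 3"
    using assms cycle_imp_cycle_mk_symmetric[OF p] unfolding oriented_tree_def by fastforce
  moreover obtain u where u: "awalk u p u" "2 \<le> length p"
    using p cycle_digraph_conv by blast
  ultimately have "length p = Suc (Suc 0)" by simp
  then obtain a b where "p = [a, b]" by (auto simp: length_Suc_conv)
  with u have "(tail T a, head T a) \<in> arcs_ends T" "(head T a, tail T a) \<in> arcs_ends T"
    by (auto simp: awalk_simps arcs_ends_conv)
  then show False using assms unfolding oriented_tree_def by blast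
qed

text \<open>Going backwards along the arcs of a finite acyclic relation must stop, and it can stop
  only at a vertex of in-degree zero.\<close>

lemma out_tree_imp_reachable:
  assumes "oriented_tree T" "\<And>v. v \<in> verts T \<Longrightarrow> in_degree T v = 0 \<Longrightarrow> v = r" "v \<in> verts T"
  shows "(r, v) \<in> (arcs_ends T)\<^sup>*"
proof -
  interpret digraph T using assms by (simp add: oriented_tree_def)
  have "wf (arcs_ends T)"
    using oriented_tree_acyclic[OF assms(1)] by (intro finite_acyclic_wf) (auto simp: arcs_ends_def)
  then show ?thesis using assms(3)
  proof (induction v)
    case (less v)
    show ?case
    proof (cases "in_arcs T v = {}")
      case True
      then show ?thesis using assms(2)[of v] less.prems by (simp add: in_degree_def)
    next
      case False
      then obtain e where "e \<in> arcs T" "head T e = v" by (auto simp: in_arcs_def)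
      then have "(tail T e, v) \<in> arcs_ends T" "tail T e \<in> verts T"
        by (auto simp: arcs_ends_conv)
      then show ?thesis using less.IH by (meson rtrancl.rtrancl_into_rtrancl)
    qed
  qed
qed

text \<open>The witness is the set of vertices with an out-arc in \<open>T\<close>; each leaf other
  than the root is entered by an arc from it. If the root has no out-arc, nothing else is reachable,
  which is the first alternative.\<close>

lemma out_tree_imp_rooted:
  assumes "out_tree T" "subgraph T (with_proj D)"
  shows "(\<exists>r. verts T = {r}) \<or>
    (\<exists>r I. I \<subseteq> pverts D \<and> rooted (parcs D) r I \<and> leaves T \<subseteq> boundary (parcs D) I)"
proof -
  interpret digraph T using assms by (simp add: out_tree_def oriented_tree_def)
  obtain r where r: "r \<in> verts T" "\<And>v. v \<in> verts T \<Longrightarrow> in_degree T v = 0 \<Longrightarrow> v = r"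
    using assms(1) unfolding out_tree_def by blast
  have reach: "(r, v) \<in> (arcs_ends T)\<^sup>*" if "v \<in> verts T" for v
    using out_tree_imp_reachable[of T r v] r that assms(1) by (auto simp: out_tree_def)
  define I where "I = Domain (arcs_ends T)"
  have sub: "arcs_ends T \<subseteq> parcs D" "verts T \<subseteq> pverts D"
    using assms(2) unfolding subgraph_def compatible_def arcs_ends_conv by auto
  have subI: "arcs_ends T \<subseteq> parcs D \<inter> I \<times> UNIV" using sub by (auto simp: I_def)
  have IV: "I \<subseteq> verts T" by (auto simp: I_def dest: adj_in_verts)
  have leaf: "v \<notin> I" if "v \<in> leaves T" for v
  proof
    assume "v \<in> I"
    then obtain e where "e \<in> out_arcs T v" by (auto simp: I_def arcs_ends_conv)
    then show False using that
      unfolding leaves_def out_degree_def by (auto simp: finite_out_arcs)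
  qed
  show ?thesis
  proof (cases "r \<in> I")
    case True
    have "I \<subseteq> (parcs D \<inter> I \<times> UNIV)\<^sup>* `` {r}"
      using reach IV rtrancl_mono[OF subI] by blast
    moreover have "v \<in> parcs D `` I" if v: "v \<in> leaves T" for v
    proof -
      have "(r, v) \<in> (arcs_ends T)\<^sup>*" "r \<noteq> v"
        using reach v leaf True by (auto simp: leaves_def)
      then obtain w where "(w, v) \<in> arcs_ends T" by (meson rtranclE)
      then show ?thesis using subI by blast
    qed
    ultimately have "rooted (parcs D) r I" "leaves T \<subseteq> boundary (parcs D) I"
      using True leaf by (auto simp: rooted_def boundary_def)
    moreover have "I \<subseteq> pverts D" using IV sub by simp
    ultimately show ?thesis by blast
  next
    case False
    have "v = r" if "v \<in> verts T" for v
      using reach[OF that] False unfolding I_def by (auto elim: converse_rtranclE)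
    then show ?thesis using r by blast
  qed
qed

section \<open>From rooted sets to out-trees\<close>

lemma pcas_consecutive:
  assumes "pcas u q v" "Suc i < length q"
  shows "snd (q ! i) = fst (q ! Suc i)"
  using assms
proof (induction q arbitrary: u i)
  case (Cons e q)
  then show ?case
    by (cases q; cases i) auto
qed simp

lemma pcas_ends:
  assumes "pcas u q v" "q \<noteq> []"
  shows "fst (q ! 0) = u" "snd (q ! (length q - 1)) = v"
proof -
  show "fst (q ! 0) = u" using assms by (cases q) auto
  show "snd (q ! (length q - 1)) = v"
    using assms
  proof (induction q arbitrary: u)
    case (Cons e q)
    then show ?case by (cases q) auto
  qed simp
qed

text \<open>Unrolling a cycle into a periodic sequence gives every vertex a successor and, after a
  shift by one period, a predecessor, without a special case where the list wraps around.\<close>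

lemma pair_cycle_periodic:
  assumes "pre_digraph.cycle (with_proj G) q"
  obtains f where "\<And>i. (f i, f (Suc i)) \<in> parcs G"
    and "\<And>i j. f i = f j \<longleftrightarrow> i mod length q = j mod length q"
proof -
  obtain u where u: "pcas u q u" "set q \<subseteq> parcs G" "distinct (tl (pawalk_verts u q))" "q \<noteq> []"
    using assms unfolding pre_digraph.cycle_def pre_digraph.awalk_def
    by (auto simp: cas_with_proj_eq awalk_verts_with_proj_eq)
  define m where "m = length q"
  have m: "m > 0" using u by (simp add: m_def)
  \<comment> \<open>Heads are listed because a cycle guarantees distinctness for the tail of its
    vertex list, and that tail is the list of heads.\<close>
  define f where "f i = snd (q ! (i mod m))" for i
  have "pre_digraph.awalk_verts (with_proj G) u q = u # map snd q"
    using pre_digraph.awalk_verts_conv'[of "with_proj G" u q u] u pcas_ends(1)[OF u(1)]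
    by (auto simp: hd_conv_nth cas_with_proj_eq)
  then have "distinct (map snd q)" using u by (simp add: awalk_verts_with_proj_eq)
  then have inj: "f i = f j \<longleftrightarrow> i mod m = j mod m" for i j
    using m nth_eq_iff_index_eq[of "map snd q" "i mod m" "j mod m"] by (simp add: f_def m_def)
  have "(f i, f (Suc i)) \<in> parcs G" for i
  proof -
    have "f i = fst (q ! (Suc i mod m))"
    proof (cases "Suc (i mod m) = m")
      case True
      then have "i mod m = m - 1" "Suc i mod m = 0" by (auto simp: mod_Suc)
      then show ?thesis using pcas_ends[OF u(1,4)] by (simp add: f_def m_def)
    next
      case False
      then have "Suc i mod m = Suc (i mod m)" "Suc (i mod m) < m"
        using m mod_less_divisor[of m i] by (auto simp: mod_Suc simp del: mod_less_divisor)
      then show ?thesis using pcas_consecutive[OF u(1)] by (simp add: f_def m_def)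
    qed
    then have "(f i, f (Suc i)) = q ! (Suc i mod m)" by (simp add: f_def prod_eq_iff)
    then show ?thesis using u(2) m by (metis m_def mod_less_divisor nth_mem subsetD)
  qed
  then show ?thesis using that inj m_def by blast
qed

text \<open>Arcs increase \<open>d\<close>, which gives reachability from \<open>r\<close> and
  excludes opposite arcs. On an undirected cycle, a vertex with maximal \<open>d\<close> is adjacent
  only to its parent, so its two neighbours on the cycle coincide, which length at least 3 rules
  out.\<close>

lemma parent_function_out_tree:
  fixes X :: "'a set" and d :: "'a \<Rightarrow> nat"
  assumes "finite X" "r \<in> X"
    and par: "\<And>v. v \<in> X \<Longrightarrow> v \<noteq> r \<Longrightarrow> p v \<in> X \<and> d (p v) < d v"
  shows "out_tree (with_proj \<lparr>pverts = X, parcs = (\<lambda>v. (p v, v)) ` (X - {r})\<rparr>)"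
    (is "out_tree (with_proj ?G)")
proof -
  let ?T = "with_proj ?G"
  have "digraph ?T"
    using assms(1) par by unfold_locales (force simp: arc_to_ends_def)+
  then interpret T: digraph ?T .
  have ends: "arcs_ends ?T = (\<lambda>v. (p v, v)) ` (X - {r})" by (auto simp: arcs_ends_def arc_to_ends_def)
  have less: "d u < d v" if "(u, v) \<in> arcs_ends ?T" for u v
    using that par by (auto simp: ends)
  have reach: "v \<in> X \<Longrightarrow> r \<rightarrow>\<^sup>*\<^bsub>?T\<^esub> v" for v
  proof (induction "d v" arbitrary: v rule: less_induct)
    case less
    show ?case
    proof (cases "v = r")
      case False
      then have "r \<rightarrow>\<^sup>*\<^bsub>?T\<^esub> p v" "(p v, v) \<in> arcs_ends ?T"
        using less par by (auto simp: ends)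
      then show ?thesis by (rule T.reachable_adj_trans)
    qed (use assms in simp)
  qed
  have "Digraph_Component.connected ?T"
  proof (rule T.connectedI)
    show "verts ?T \<noteq> {}" using assms(2) by auto
    fix u v assume uv: "u \<in> verts ?T" "v \<in> verts ?T"
    let ?S = "with_proj (mk_symmetric ?T)"
    interpret S: pair_wf_digraph "mk_symmetric ?T" by (rule T.wellformed_mk_symmetric)
    interpret S: sym_digraph ?S
      by unfold_locales (rule symmetric_mk_symmetric)
    have "r \<rightarrow>\<^sup>*\<^bsub>?S\<^esub> u" "r \<rightarrow>\<^sup>*\<^bsub>?S\<^esub> v"
      using uv reach T.reachable_mk_symmetricI by auto
    then show "u \<rightarrow>\<^sup>*\<^bsub>?S\<^esub> v"
      using S.symmetric_reachable' S.reachable_trans by blast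
  qed
  moreover have no_cycle: "\<not> pre_digraph.cycle (with_proj (mk_symmetric ?T)) q" if len: "3 \<le> length q" for q
  proof
    assume "pre_digraph.cycle (with_proj (mk_symmetric ?T)) q"
    then obtain f where f: "\<And>i. (f i, f (Suc i)) \<in> parcs (mk_symmetric ?T)"
      and per: "\<And>i j. f i = f j \<longleftrightarrow> i mod length q = j mod length q"
      by (rule pair_cycle_periodic) blast
    have "finite (range f)"
    proof (rule finite_subset)
      show "range f \<subseteq> X" 
      proof safe
        fix i
        have "f i \<in> pverts (mk_symmetric ?T)"
          using f[of i] T.wellformed_mk_symmetric by (rule pair_wf_digraph.in_arcsD1[rotated])
        then show "f i \<in> X" by simp
      qed
    qed (fact assms)
    then have "finite (range (d \<circ> f))" by (metis finite_imageI image_comp)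
    then obtain i0 where "(d \<circ> f) i0 = Max (range (d \<circ> f))"
      using Max_in[of "range (d \<circ> f)"] by (metis (no_types) UNIV_not_empty empty_is_image imageE)
    then have i0: "d (f i) \<le> d (f i0)" for i
      using \<open>finite (range (d \<circ> f))\<close> by simp
    \<comment> \<open>A full period is added so that the maximal vertex has a predecessor index even
      if \<open>i0\<close> is 0.\<close>
    define j where "j = i0 + length q - 1"
    have "Suc j = i0 + length q" using len by (simp add: j_def)
    then have "f (Suc j) = f i0" by (simp add: per)
    then have max: "d (f i) \<le> d (f (Suc j))" for i using i0 by simp
    \<comment> \<open>An arc leaving the maximal vertex would lead to a larger \<open>d\<close>; so
      the arc enters it, and hence comes from its parent.\<close>
    have par_max: "w = p (f (Suc j))"
      if "(w, f (Suc j)) \<in> parcs (mk_symmetric ?T)" "d w \<le> d (f (Suc j))" for w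
    proof -
      have "(w, f (Suc j)) \<in> arcs_ends ?T \<or> (f (Suc j), w) \<in> arcs_ends ?T"
        using that(1) by (auto simp: mk_symmetric_def)
      then show ?thesis using that(2) less[of "f (Suc j)" w] by (auto simp: ends)
    qed
    have "f j = p (f (Suc j))" "f (Suc (Suc j)) = p (f (Suc j))"
      using par_max[of "f j"] par_max[of "f (Suc (Suc j))"] f[of j] f[of "Suc j"] max
      by (auto simp: mk_symmetric_def)
    then have "j mod length q = Suc (Suc j) mod length q" using per by metis
    then have "length q dvd Suc (Suc j) - j"
      using mod_eq_dvd_iff_nat[of j "Suc (Suc j)" "length q"] by simp
    then show False using len by (auto dest: dvd_imp_le)
  qed
  moreover have "\<exists>!v. v \<in> verts ?T \<and> in_degree ?T v = 0"
  proof (rule ex1I[of _ r])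
    have "in_arcs ?T r = {}" by auto
    then show "r \<in> verts ?T \<and> in_degree ?T r = 0" using assms by (simp add: in_degree_def)
    fix v assume v: "v \<in> verts ?T \<and> in_degree ?T v = 0"
    then have "in_arcs ?T v = {}" by (simp add: in_degree_def T.finite_in_arcs)
    then show "v = r" using v by (force simp: in_arcs_def)
  qed
  moreover have "(v, u) \<notin> arcs_ends ?T" if "(u, v) \<in> arcs_ends ?T" for u v
    using less[OF that] less[of v u] by linarith
  ultimately show ?thesis
    using \<open>digraph ?T\<close> no_cycle unfolding out_tree_def oriented_tree_def
    by (intro conjI allI impI notI) (assumption | elim exE conjE | simp)+
qed

text \<open>The tree is a breadth-first tree of \<open>W\<close>. Every parent is the tail of an arc
  of \<open>W\<close> and so lies in \<open>I\<close>; hence boundary vertices have no children.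
  Vertices of \<open>I\<close> may be childless as well, whence only an inclusion.\<close>

lemma rooted_imp_out_tree:
  assumes "pair_digraph D" "I \<subseteq> pverts D" "rooted (parcs D) r I"
  shows "\<exists>T. subgraph T (with_proj D) \<and> out_tree T \<and> boundary (parcs D) I \<subseteq> leaves T"
proof -
  interpret D: pair_digraph D by fact
  define W where "W = parcs D \<inter> I \<times> UNIV"
  \<comment> \<open>Only the tails are restricted to \<open>I\<close>, so \<open>X\<close> contains
    the boundary of \<open>I\<close> besides \<open>I\<close> itself.\<close>
  define X where "X = W\<^sup>* `` {r}"
  define d where "d v = (LEAST n. (r, v) \<in> W ^^ n)" for v
  have r: "r \<in> I" "r \<in> X" and IX: "I \<subseteq> X"
    using assms(3) by (auto simp: X_def rooted_def W_def)
  have XV: "X \<subseteq> pverts D"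
  proof
    fix v assume "v \<in> X"
    then have "(r, v) \<in> W\<^sup>*" by (simp add: X_def)
    then show "v \<in> pverts D" using r assms(2)
      by (induction rule: rtrancl_induct) (auto simp: W_def dest: D.in_arcsD2)
  qed
  have "\<exists>u. (u, v) \<in> W \<and> u \<in> X \<and> d u < d v" if "v \<in> X" "v \<noteq> r" for v
  proof -
    have "\<exists>n. (r, v) \<in> W ^^ n" using that by (simp add: X_def rtrancl_power)
    then have "(r, v) \<in> W ^^ d v" unfolding d_def by (rule LeastI_ex)
    moreover obtain m where m: "d v = Suc m"
      using calculation \<open>v \<noteq> r\<close> by (cases "d v") auto
    ultimately obtain u where u: "(r, u) \<in> W ^^ m" "(u, v) \<in> W" by auto
    then have "d u \<le> m" unfolding d_def by (intro Least_le)
    then show ?thesis using u m by (auto simp: X_def relpow_imp_rtrancl)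
  qed
  then obtain p where p: "\<And>v. v \<in> X \<Longrightarrow> v \<noteq> r \<Longrightarrow> (p v, v) \<in> W \<and> p v \<in> X \<and> d (p v) < d v"
    by metis
  let ?T = "with_proj \<lparr>pverts = X, parcs = (\<lambda>v. (p v, v)) ` (X - {r})\<rparr>"
  have "out_tree ?T"
    using p r(2) finite_subset[OF XV]
    by (intro parent_function_out_tree[where d = d]) auto
  moreover have "subgraph ?T (with_proj D)"
  proof (rule subgraphI)
    show "wf_digraph ?T"
      using \<open>out_tree ?T\<close> by (simp add: out_tree_def oriented_tree_def digraph_def fin_digraph_def)
  qed (use XV p in \<open>auto simp: W_def compatible_def D.wf_digraph\<close>)
  moreover have "boundary (parcs D) I \<subseteq> leaves ?T"
  proof
    fix v assume v: "v \<in> boundary (parcs D) I"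
    then obtain u where u: "u \<in> I" "(u, v) \<in> W" by (auto simp: boundary_def W_def)
    then have "v \<in> X" using IX by (auto simp: X_def intro: rtrancl_into_rtrancl)
    moreover have "out_arcs ?T v = {}"
      using v p by (force simp: boundary_def W_def out_arcs_def)
    ultimately show "v \<in> leaves ?T" by (simp add: leaves_def out_degree_def)
  qed
  ultimately show ?thesis by blast
qed

lemma has_out_tree_iff_rooted:
  assumes "pair_digraph D" "0 < k"
  shows "has_out_tree_with_leaves (with_proj D) k \<longleftrightarrow>
    k = 1 \<and> pverts D \<noteq> {} \<or>
    (\<exists>r I. I \<subseteq> pverts D \<and> rooted (parcs D) r I \<and> k \<le> card (boundary (parcs D) I))"
  (is "?L \<longleftrightarrow> ?one \<or> ?R")
proof
  interpret D: pair_digraph D by fact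
  have fin: "finite (boundary (parcs D) I)" for I
    by (rule finite_subset[OF _ D.finite_verts]) (auto simp: boundary_def dest: D.in_arcsD2)
  assume ?L
  then obtain T where T: "subgraph T (with_proj D)" "out_tree T" "k \<le> card (leaves T)"
    by (auto simp: has_out_tree_with_leaves_def)
  from out_tree_imp_rooted[OF T(2,1)] show "?one \<or> ?R"
  proof
    assume "\<exists>r. verts T = {r}"
    then obtain r where r: "verts T = {r}" by blast
    then have "card (leaves T) \<le> 1"
      using card_mono[of "{r}" "leaves T"] by (auto simp: leaves_def)
    moreover have "r \<in> pverts D" using T(1) r by auto
    ultimately show ?thesis using T(3) assms(2) by auto
  next
    assume "\<exists>r I. I \<subseteq> pverts D \<and> rooted (parcs D) r I \<and> leaves T \<subseteq> boundary (parcs D) I"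
    then obtain r I where I: "I \<subseteq> pverts D" "rooted (parcs D) r I"
      and le: "leaves T \<subseteq> boundary (parcs D) I" by blast
    have "k \<le> card (boundary (parcs D) I)"
      using T(3) card_mono[OF fin le] by simp
    then show ?thesis using I by blast
  qed
next
  interpret D: pair_digraph D by fact
  assume "?one \<or> ?R"
  then show ?L
  proof
    assume one: ?one
    then obtain r where r: "r \<in> pverts D" by blast
    let ?T = "with_proj \<lparr>pverts = {r}, parcs = {}\<rparr>"
    have "out_tree ?T" using parent_function_out_tree[of "{r}" r] by simp
    moreover have "subgraph ?T (with_proj D)"
      using r by (intro subgraphI) (auto simp: compatible_def wf_digraph_def D.wf_digraph)
    moreover have "k \<le> card (leaves ?T)"
      using one by (simp add: leaves_def out_degree_def out_arcs_def)
    ultimately show ?thesis unfolding has_out_tree_with_leaves_def by blast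
  next
    assume ?R
    then obtain r I where I: "I \<subseteq> pverts D" "rooted (parcs D) r I"
      "k \<le> card (boundary (parcs D) I)" by blast
    obtain T where T: "subgraph T (with_proj D)" "out_tree T" "boundary (parcs D) I \<subseteq> leaves T"
      using rooted_imp_out_tree[OF assms(1) I(1,2)] by blast
    have "finite (leaves T)"
      using T(1) finite_subset[OF _ D.finite_verts] by (auto simp: leaves_def subgraph_def)
    then have "k \<le> card (leaves T)"
      using I(3) card_mono[OF _ T(3)] by (meson order_trans)
    then show ?thesis using T unfolding has_out_tree_with_leaves_def by blast
  qed
qed

section \<open>The search on coloured vertices\<close>

text \<open>
  Colour 0 means not seen yet, 1 undecided boundary vertex, 2 red boundary vertex, 3 element of \<open>I\<close>.
\<close>

type_synonym colouring = "nat \<Rightarrow> nat"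

definition inner :: "colouring \<Rightarrow> nat set" where
  "inner c = {v. c v = 3}"

definition red :: "colouring \<Rightarrow> nat set" where
  "red c = {v. c v = 2}"

definition fringe :: "colouring \<Rightarrow> nat set" where
  "fringe c = {v. c v = 1 \<or> c v = 2}"

definition expand :: "(nat \<times> nat) set \<Rightarrow> nat \<Rightarrow> colouring \<Rightarrow> colouring" where
  "expand E u c = (\<lambda>v. if v = u then 3 else if (u, v) \<in> E \<and> c v = 0 then 1 else c v)"

definition fresh :: "(nat \<times> nat) set \<Rightarrow> nat \<Rightarrow> colouring \<Rightarrow> nat set" where
  "fresh E u c = {v. v \<noteq> u \<and> (u, v) \<in> E \<and> c v = 0}"

text \<open>The second component holds the new out-neighbours of the vertex that joined last. The
  step stays put once they are not exactly one, so a fixed number of iterations can stand for a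
  conditional loop.\<close>

definition chain :: "(nat \<times> nat) set \<Rightarrow> colouring \<times> nat set \<Rightarrow> colouring \<times> nat set" where
  "chain E = (\<lambda>(c, S). if card S = 1
     then (expand E (the_elem S) c, fresh E (the_elem S) c) else (c, S))"

definition absorb :: "(nat \<times> nat) set \<Rightarrow> nat \<Rightarrow> nat \<Rightarrow> colouring \<Rightarrow> colouring" where
  "absorb E n u c = fst ((chain E ^^ n) (expand E u c, fresh E u c))"

text \<open>
  The number \<open>y\<close> encodes the remaining \<open>i\<close> decisions in binary, the most significant bit first.
\<close>

primrec search :: "(nat \<times> nat) set \<Rightarrow> nat \<Rightarrow> nat \<Rightarrow> nat \<Rightarrow> colouring \<Rightarrow> colouring" where
  "search E n 0 y c = c"
| "search E n (Suc i) y c =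
     (if \<exists>v<n. c v = 1 then
        let u = Max {v. v < n \<and> c v = 1}
        in if 2 ^ i \<le> y then search E n i (y - 2 ^ i) (absorb E n u c)
           else search E n i y (c(u := 2))
      else search E n i y c)"

text \<open>The soundness invariant, preserved under either value of each bit. Its last conjunct
  keeps all sets inside \<open>{..<n}\<close>, which bounds the length of chains and lets the
  program clear a colouring by touching \<open>n\<close> cells.\<close>

definition valid :: "(nat \<times> nat) set \<Rightarrow> nat \<Rightarrow> nat \<Rightarrow> colouring \<Rightarrow> bool" where
  "valid E n r c \<longleftrightarrow> rooted E r (inner c) \<and> boundary E (inner c) = fringe c \<and>
     (\<forall>v. c v \<le> 3) \<and> (\<forall>v\<ge>n. c v = 0)"

section \<open>Validity is preserved by the search\<close>

lemma rooted_insert: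
  assumes "rooted E r I" "u \<in> E `` I"
  shows "rooted E r (insert u I)"
proof -
  let ?W = "E \<inter> insert u I \<times> UNIV"
  have sub: "(E \<inter> I \<times> UNIV)\<^sup>* \<subseteq> ?W\<^sup>*" by (intro rtrancl_mono) auto
  then have "I \<subseteq> ?W\<^sup>* `` {r}" using assms by (auto simp: rooted_def)
  moreover obtain x where "x \<in> I" "(x, u) \<in> ?W" using assms by auto
  ultimately have "u \<in> ?W\<^sup>* `` {r}" by (auto intro: rtrancl_into_rtrancl)
  then show ?thesis using \<open>I \<subseteq> ?W\<^sup>* `` {r}\<close> assms(1) by (auto simp: rooted_def)
qed

lemma le3_cases: "(c :: nat) \<le> 3 \<longleftrightarrow> c = 0 \<or> c = 1 \<or> c = 2 \<or> c = 3"
  by auto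

lemma valid_lt: "valid E n r c \<Longrightarrow> c v \<noteq> 0 \<Longrightarrow> v < n"
  unfolding valid_def by (meson leI)

lemma valid_finite:
  assumes "valid E n r c"
  shows "finite (inner c)" "finite (fringe c)" "inner c \<subseteq> {..<n}" "card (inner c) \<le> n"
proof -
  show sub: "inner c \<subseteq> {..<n}"
    using valid_lt[OF assms] by (auto simp: inner_def)
  have "fringe c \<subseteq> {..<n}"
    using valid_lt[OF assms] by (auto simp: fringe_def)
  then show "finite (inner c)" "finite (fringe c)" using sub finite_subset by auto
  show "card (inner c) \<le> n" using card_mono[OF _ sub] by simp
qed

lemma inner_expand: "inner (expand E u c) = insert u (inner c)"
  by (auto simp: inner_def expand_def)

lemma red_expand: "c u = 1 \<Longrightarrow> red (expand E u c) = red c"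
  by (auto simp: red_def expand_def)

lemma fringe_expand: "fringe (expand E u c) = fringe c - {u} \<union> fresh E u c"
  by (auto simp: fringe_def expand_def fresh_def)

lemma valid_start:
  assumes "r < n" "E \<subseteq> {..<n} \<times> {..<n}"
  shows "valid E n r (expand E r (\<lambda>_. 0))"
proof -
  have "inner (expand E r (\<lambda>_. 0)) = {r}" by (auto simp: inner_def expand_def)
  then show ?thesis
    using assms by (auto simp: valid_def rooted_def boundary_def fringe_def expand_def)
qed

lemma valid_expand:
  assumes "valid E n r c" "c u = 1" "E \<subseteq> {..<n} \<times> {..<n}"
  shows "valid E n r (expand E u c)"
proof -
  have b: "boundary E (inner c) = fringe c" using assms by (simp add: valid_def)
  have c: "c v = 0 \<or> c v = 1 \<or> c v = 2 \<or> c v = 3" for v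
    using assms by (simp add: valid_def le3_cases)
  have "u \<in> fringe c" using assms by (simp add: fringe_def)
  then have "u \<in> E `` inner c" using b by (auto simp: boundary_def)
  then have "rooted E r (insert u (inner c))"
    using assms by (intro rooted_insert) (auto simp: valid_def)
  moreover have "boundary E (insert u (inner c)) = boundary E (inner c) - {u} \<union> fresh E u c"
    (is "_ = ?R")
  proof (rule set_eqI)
    fix v
    have "v \<in> boundary E (inner c) \<longleftrightarrow> c v = 1 \<or> c v = 2"
      using b by (simp add: fringe_def)
    then show "v \<in> boundary E (insert u (inner c)) \<longleftrightarrow> v \<in> ?R"
      using c[of v] by (auto simp: boundary_def fresh_def inner_def)
  qed
  moreover have "u < n" using assms valid_lt by fastforce
  moreover have "\<forall>v. expand E u c v \<le> 3" "\<forall>v\<ge>n. expand E u c v = 0"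
    using assms(1,3) \<open>u < n\<close> by (auto simp: valid_def expand_def)
  ultimately show ?thesis
    using b by (simp add: valid_def inner_expand fringe_expand)
qed

lemma valid_red:
  assumes "valid E n r c" "c u = 1"
  shows "valid E n r (c(u := 2))"
proof -
  have "inner (c(u := 2)) = inner c" "fringe (c(u := 2)) = fringe c"
    using assms(2) by (auto simp: inner_def fringe_def)
  moreover have "u < n" using assms valid_lt by fastforce
  ultimately show ?thesis using assms by (auto simp: valid_def)
qed

lemma fresh_blue: "fresh E u c \<subseteq> {v. expand E u c v = 1}"
  by (auto simp: fresh_def expand_def)

lemma card_1_the_elem: "card S = 1 \<Longrightarrow> S = {the_elem S}"
  by (metis card_1_singletonE the_elem_eq)

text \<open>The set \<open>S\<close> is kept among the undecided vertices because the vertex that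
  joins next has to be a boundary vertex.\<close>

lemma valid_chain:
  assumes "valid E n r c" "S \<subseteq> {v. c v = 1}" "E \<subseteq> {..<n} \<times> {..<n}" "chain E (c, S) = (c', S')"
  shows "valid E n r c' \<and> S' \<subseteq> {v. c' v = 1}"
proof (cases "card S = 1")
  case True
  then have "c (the_elem S) = 1" using assms(2) card_1_the_elem by blast
  then show ?thesis
    using assms True valid_expand[OF assms(1)] fresh_blue[of E "the_elem S" c]
    by (auto simp: chain_def)
next
  case False
  then show ?thesis using assms by (auto simp: chain_def)
qed

lemma valid_absorb:
  assumes "valid E n r c" "c u = 1" "E \<subseteq> {..<n} \<times> {..<n}"
  shows "valid E n r (absorb E n u c)"
proof -
  have "valid E n r (fst ((chain E ^^ j) (expand E u c, fresh E u c))) \<and>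
    snd ((chain E ^^ j) (expand E u c, fresh E u c)) \<subseteq>
      {v. fst ((chain E ^^ j) (expand E u c, fresh E u c)) v = 1}" for j
  proof (induction j)
    case 0
    show ?case using valid_expand[OF assms] fresh_blue[of E u c] by simp
  next
    case (Suc j)
    obtain c' S' where c': "(chain E ^^ j) (expand E u c, fresh E u c) = (c', S')" by force
    then have "valid E n r c'" "S' \<subseteq> {v. c' v = 1}" using Suc by auto
    moreover obtain c'' S'' where c'': "chain E (c', S') = (c'', S'')" by force
    ultimately have "valid E n r c'' \<and> S'' \<subseteq> {v. c'' v = 1}"
      using valid_chain[OF _ _ assms(3)] by blast
    then show ?case using c' c'' by simp
  qed
  then show ?thesis by (simp add: absorb_def)
qed

lemma Max_blue:
  fixes c :: colouring
  assumes "\<exists>v<n. c v = 1"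
  shows "c (Max {v. v < n \<and> c v = 1}) = 1" "Max {v. v < n \<and> c v = 1} < n"
proof -
  have "finite {v. v < n \<and> c v = 1}" by (rule finite_subset[of _ "{..<n}"]) auto
  moreover have "{v. v < n \<and> c v = 1} \<noteq> {}" using assms by auto
  ultimately have "finite {v. v < n \<and> c v = 1}" "{v. v < n \<and> c v = 1} \<noteq> {}" .
  from Max_in[OF this] show "c (Max {v. v < n \<and> c v = 1}) = 1" "Max {v. v < n \<and> c v = 1} < n"
    by simp_all
qed

lemma valid_search:
  assumes "valid E n r c" "E \<subseteq> {..<n} \<times> {..<n}"
  shows "valid E n r (search E n i y c)"
  using assms(1)
proof (induction i arbitrary: y c)
  case (Suc i)
  show ?case
  proof (cases "\<exists>v<n. c v = 1")
    case True
    note u = Max_blue(1)[OF True]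
    show ?thesis
      using True Suc.IH valid_absorb[OF Suc.prems u assms(2)] valid_red[OF Suc.prems u]
      by (simp only: search.simps Let_def if_True if_split) simp
  next
    case False
    then show ?thesis using Suc by auto
  qed
qed simp

section \<open>Some bit string follows a minimum solution\<close>

definition optimal :: "(nat \<times> nat) set \<Rightarrow> nat \<Rightarrow> nat \<Rightarrow> nat set \<Rightarrow> bool" where
  "optimal E r k J \<longleftrightarrow> rooted E r J \<and> k \<le> card (boundary E J) \<and>
     (\<forall>J'. rooted E r J' \<and> finite J' \<and> k \<le> card (boundary E J') \<longrightarrow> card J \<le> card J')"

text \<open>
  If \<open>F\<close> has at most one element and misses \<open>J\<close>, then \<open>J - {u}\<close> is still rooted (what is reached from
  \<open>u\<close> inside \<open>J\<close> is also reached from \<open>I\<close>) and trades the boundary vertex in \<open>F\<close> for \<open>u\<close>.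
\<close>

lemma optimal_no_detour:
  assumes "optimal E r k J" "finite J" "finite E"
    and I: "rooted E r I" "I \<subseteq> J" and u: "u \<in> boundary E I" "u \<in> J"
    and F: "F = E `` {u} - (I \<union> E `` I)"
  shows "F \<noteq> {}" and "card F = 1 \<Longrightarrow> F \<subseteq> J"
proof -
  have "\<not> (F \<inter> J = {} \<and> card F \<le> 1)"
  proof safe
    assume FJ: "F \<inter> J = {}" and F1: "card F \<le> 1"
    define J' where "J' = J - {u}"
    define W where "W = E \<inter> J \<times> UNIV"
    define W' where "W' = E \<inter> J' \<times> UNIV"
    have r: "r \<in> I" "r \<in> J'" using I u by (auto simp: rooted_def J'_def boundary_def)
    have IJ': "I \<subseteq> J'" using I u by (auto simp: J'_def boundary_def)
    have "(E \<inter> I \<times> UNIV)\<^sup>* \<subseteq> W'\<^sup>*" using IJ' by (intro rtrancl_mono) (auto simp: W'_def)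
    then have reachI: "(r, x) \<in> W'\<^sup>*" if "x \<in> I" for x
      using I(1) that by (auto simp: rooted_def)
    have reachEI: "(r, x) \<in> W'\<^sup>*" if x: "x \<in> E `` I" for x
    proof -
      obtain i where i: "i \<in> I" "(i, x) \<in> E" using x by auto
      then have "(i, x) \<in> W'" using IJ' by (auto simp: W'_def)
      then show ?thesis using reachI[OF i(1)] by (rule rtrancl_into_rtrancl[rotated])
    qed
    \<comment> \<open>An implication, because the walk within \<open>J\<close> may pass through the
      removed vertex \<open>u\<close>.\<close>
    have reach: "x \<in> J' \<longrightarrow> (r, x) \<in> W'\<^sup>*" if "(r, x) \<in> W\<^sup>*" for x
      using that
    proof (induction rule: rtrancl_induct)
      case (step x z)
      show ?case
      proof
        assume z: "z \<in> J'"
        show "(r, z) \<in> W'\<^sup>*"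
        proof (cases "x = u")
          case True
          \<comment> \<open>A step from \<open>u\<close> to a vertex of \<open>J\<close> misses
            \<open>F\<close>, so it ends in \<open>I\<close> or at an out-neighbour of
            \<open>I\<close>, and the walk can be replaced by one that avoids
            \<open>u\<close>.\<close>
          then have "z \<in> I \<union> E `` I" using step z FJ by (auto simp: W_def F J'_def)
          then show ?thesis using reachI reachEI by blast
        next
          case False
          then have "x \<in> J'" "(x, z) \<in> W'" using step by (auto simp: W_def W'_def J'_def)
          then show ?thesis using step.IH by (meson rtrancl_into_rtrancl)
        qed
      qed
    qed simp
    have "J' \<subseteq> W'\<^sup>* `` {r}"
      using reach assms(1) by (auto simp: optimal_def rooted_def J'_def W_def)
    then have "rooted E r J'" using r by (simp add: rooted_def W'_def)
    moreover have "k \<le> card (boundary E J')"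
    proof -
      have fin: "finite (boundary E K)" for K
        using \<open>finite E\<close> by (simp add: boundary_def finite_Image)
      \<comment> \<open>Boundary vertices seen from \<open>u\<close> but outside \<open>F\<close>
        also have a predecessor in \<open>I\<close>, so only elements of \<open>F\<close> can be
        lost; in exchange \<open>u\<close>, an out-neighbour of \<open>I\<close>, enters the
        boundary.\<close>
      have "insert u (boundary E J - F) \<subseteq> boundary E J'"
        using u IJ' by (auto simp: boundary_def F J'_def)
      then have "card (insert u (boundary E J - F)) \<le> card (boundary E J')"
        by (intro card_mono fin)
      moreover have "card (insert u (boundary E J - F)) = Suc (card (boundary E J - F))"
        using u fin by (intro card_insert_disjoint) (auto simp: boundary_def)
      moreover have "card (boundary E J) - card F \<le> card (boundary E J - F)"
        by (rule diff_card_le_card_Diff) (simp add: F assms(3) finite_Image)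
      ultimately show ?thesis using assms(1) F1 by (auto simp: optimal_def)
    qed
    ultimately have "card J \<le> card J'"
      using assms(1,2) by (auto simp: optimal_def J'_def)
    moreover have "card J' < card J" unfolding J'_def using assms(2) u(2) by (rule card_Diff1_less)
    ultimately show False by simp
  qed
  then have *: "F \<inter> J \<noteq> {} \<or> \<not> card F \<le> 1" by blast
  then show "F \<noteq> {}" by auto
  assume "card F = 1"
  then obtain y where "F = {y}" by (rule card_1_singletonE)
  then show "F \<subseteq> J" using * by auto
qed

text \<open>This identifies \<open>fresh\<close> with the set \<open>F\<close> of
  \<open>optimal_no_detour\<close>: in a valid colouring, colour 0 means neither in the inner set
  nor an out-neighbour of it, and \<open>u\<close> itself is such an out-neighbour.\<close>

lemma fresh_eq:
  assumes "valid E n r c" "c u = 1"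
  shows "fresh E u c = E `` {u} - (inner c \<union> E `` inner c)"
proof (rule set_eqI)
  fix v
  have "v \<in> boundary E (inner c) \<longleftrightarrow> c v = 1 \<or> c v = 2" "u \<in> boundary E (inner c)"
    using assms by (auto simp: valid_def fringe_def)
  moreover have "c v = 0 \<or> c v = 1 \<or> c v = 2 \<or> c v = 3"
    using assms by (simp add: valid_def le3_cases)
  ultimately show "v \<in> fresh E u c \<longleftrightarrow> v \<in> E `` {u} - (inner c \<union> E `` inner c)"
    by (auto simp: boundary_def fresh_def inner_def)
qed

definition consistent :: "nat set \<Rightarrow> colouring \<Rightarrow> bool" where
  "consistent J c \<longleftrightarrow> inner c \<subseteq> J \<and> red c \<inter> J = {}"

text \<open>Minimality of \<open>J\<close> enters through \<open>optimal_no_detour\<close>: a vertex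
  of \<open>J\<close> has some fresh out-neighbour, and a unique one is in \<open>J\<close> too, so
  that following the chain remains consistent with \<open>J\<close>.\<close>

lemma expand_optimal:
  assumes "optimal E r k J" "finite J" "E \<subseteq> {..<n} \<times> {..<n}"
    and "valid E n r c" "consistent J c" "c u = 1" "u \<in> J"
  shows "consistent J (expand E u c)" "fresh E u c \<noteq> {}" "finite (fresh E u c)"
    and "card (fresh E u c) = 1 \<Longrightarrow> fresh E u c \<subseteq> J"
    and "Suc (card (fringe (expand E u c))) = card (fringe c) + card (fresh E u c)"
    and "card (inner (expand E u c)) = Suc (card (inner c))"
proof -
  have finE: "finite E" using assms(3) by (rule finite_subset) simp
  have "u \<in> boundary E (inner c)" using assms by (auto simp: valid_def fringe_def)
  then show "fresh E u c \<noteq> {}" "card (fresh E u c) = 1 \<Longrightarrow> fresh E u c \<subseteq> J"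
    using optimal_no_detour[OF assms(1,2) finE _ _ _ \<open>u \<in> J\<close> fresh_eq[OF assms(4,6)]] assms
    by (auto simp: valid_def consistent_def)
  show "consistent J (expand E u c)"
    using assms by (auto simp: consistent_def inner_expand red_expand)
  show fin: "finite (fresh E u c)"
    using finite_Image[OF finE, of "{u}"] by (rule finite_subset[rotated]) (auto simp: fresh_def)
  have "u \<in> fringe c" "u \<notin> inner c" using assms by (auto simp: fringe_def inner_def)
  then show "card (inner (expand E u c)) = Suc (card (inner c))"
    using valid_finite[OF assms(4)] by (simp add: inner_expand)
  have "card (fringe (expand E u c)) = card (fringe c - {u}) + card (fresh E u c)"
    unfolding fringe_expand using valid_finite[OF assms(4)] fin
    by (intro card_Un_disjoint) (auto simp: fringe_def fresh_def)
  moreover have "card (fringe c) = Suc (card (fringe c - {u}))"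
    using \<open>u \<in> fringe c\<close> valid_finite[OF assms(4)] by (metis card_Suc_Diff1)
  ultimately show "Suc (card (fringe (expand E u c))) = card (fringe c) + card (fresh E u c)"
    by simp
qed

text \<open>While the chain runs, each joining vertex is replaced by one new boundary vertex. Since
  it cannot end with no new vertex, it ends with at least two, and the boundary has grown.\<close>

lemma absorb_optimal:
  assumes "optimal E r k J" "finite J" "E \<subseteq> {..<n} \<times> {..<n}"
    and "valid E n r c" "consistent J c" "c u = 1" "u \<in> J"
  defines "c' \<equiv> absorb E n u c"
  shows "consistent J c'" "red c' = red c" "card (fringe c) < card (fringe c')"
proof -
  define st where "st j = (chain E ^^ j) (expand E u c, fresh E u c)" for j
  \<comment> \<open>The conjunct \<open>j < card (inner a)\<close> measures progress: as long as the
    chain has not stopped, every round has added a vertex.\<close>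
  have "case st j of (a, S) \<Rightarrow> valid E n r a \<and> consistent J a \<and> red a = red c \<and>
      S \<subseteq> {v. a v = 1} \<and> S \<noteq> {} \<and> finite S \<and>
      (card S = 1 \<longrightarrow> S \<subseteq> J \<and> card (fringe a) = card (fringe c) \<and> j < card (inner a)) \<and>
      (card S \<noteq> 1 \<longrightarrow> card (fringe c) < card (fringe a))" for j
  proof (induction j)
    case 0
    note e = expand_optimal[OF assms(1-7)]
    have "card (fresh E u c) > 0" using e by (simp add: card_gt_0_iff)
    moreover have "card (fresh E u c) \<noteq> 1 \<Longrightarrow> card (fringe c) < card (fringe (expand E u c))"
      using e(5) calculation by linarith
    ultimately show ?case
      using e valid_expand[OF assms(4,6,3)] fresh_blue[of E u c] assms(6)
      by (auto simp: st_def red_expand)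
  next
    case (Suc j)
    obtain a S where aS: "st j = (a, S)" by force
    show ?case
    proof (cases "card S = 1")
      case True
      obtain w where w: "S = {w}" using True by (metis card_1_singletonE)
      then have aw: "a w = 1" "w \<in> J" "valid E n r a" "consistent J a"
        and IH: "red a = red c" "card (fringe a) = card (fringe c)" "j < card (inner a)"
        using Suc aS by auto
      note e = expand_optimal[OF assms(1-3) aw(3,4,1,2)]
      have "card (fresh E w a) > 0" using e by (simp add: card_gt_0_iff)
      moreover have "card (fresh E w a) \<noteq> 1 \<Longrightarrow> card (fringe a) < card (fringe (expand E w a))"
        using e(5) calculation by linarith
      moreover have "st (Suc j) = (expand E w a, fresh E w a)"
        using aS w by (simp add: st_def chain_def)
      ultimately show ?thesis
        using e valid_expand[OF aw(3,1) assms(3)] fresh_blue[of E w a] aw IH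
        by (auto simp: red_expand)
    next
      case False
      then have "st (Suc j) = st j" using aS by (simp add: st_def chain_def)
      then show ?thesis using Suc False aS by simp
    qed
  qed
  \<comment> \<open>After \<open>n\<close> rounds a chain still running would have more than
    \<open>n\<close> inner vertices, contradicting \<open>valid_finite(4)\<close>.\<close>
  from this[of n] have *: "case st n of (a, S) \<Rightarrow> consistent J a \<and> red a = red c \<and>
    card (fringe c) < card (fringe a)"
    by (auto split: prod.splits dest!: valid_finite(4))
  then show "consistent J c'" "red c' = red c" "card (fringe c) < card (fringe c')"
    by (auto simp: c'_def absorb_def st_def split: prod.splits)
qed

lemma search_no_blue: "\<not> (\<exists>v<n. c v = 1) \<Longrightarrow> search E n i y c = c"
  by (induction i arbitrary: y) auto

text \<open>
  If no undecided vertex is left, every boundary vertex is red, so \<open>J\<close> cannot leave the current set.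
\<close>

lemma search_complete:
  assumes "optimal E r k J" "finite J" "E \<subseteq> {..<n} \<times> {..<n}"
    and "valid E n r c" "consistent J c" "2 * k \<le> m + card (red c) + card (fringe c)"
  shows "\<exists>y<2 ^ m. k \<le> card (fringe (search E n m y c))"
  using assms(4-6)
proof (induction m arbitrary: c)
  case 0
  \<comment> \<open>Half of the potential is enough: with no bits left, \<open>2 * k\<close> is at
    most twice the size of the fringe.\<close>
  have "card (red c) \<le> card (fringe c)"
    using valid_finite[OF 0(1)] by (intro card_mono) (auto simp: red_def fringe_def)
  then show ?case using 0 by simp
next
  case (Suc m)
  show ?case
  proof (cases "\<exists>v<n. c v = 1")
    case False
    have "c v \<noteq> 1" for v
      using False valid_lt[OF Suc.prems(1), of v] by auto
    then have "fringe c = red c"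
      by (simp add: fringe_def red_def)
    have "z \<in> J \<longrightarrow> z \<in> inner c" if "(r, z) \<in> (E \<inter> J \<times> UNIV)\<^sup>*" for z
      using that
    proof (induction rule: rtrancl_induct)
      case base
      then show ?case using Suc.prems(1) by (simp add: valid_def rooted_def)
    next
      case (step x z)
      then have "z \<in> inner c \<or> z \<in> fringe c"
        using Suc.prems(1) by (auto simp: valid_def boundary_def)
      then show ?case using Suc.prems(2) \<open>fringe c = red c\<close> by (auto simp: consistent_def)
    qed
    then have "J = inner c"
      using assms(1) Suc.prems(2) by (auto simp: optimal_def rooted_def consistent_def)
    then have "k \<le> card (fringe c)"
      using assms(1) Suc.prems(1) by (simp add: optimal_def valid_def)
    then show ?thesis using search_no_blue[OF False, of E "Suc m" 0] by (intro exI[of _ 0]) (simp del: search.simps)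
  next
    case True
    define u where "u = Max {v. v < n \<and> c v = 1}"
    have u: "c u = 1" using Max_blue(1)[OF True] by (simp add: u_def)
    show ?thesis
    proof (cases "u \<in> J")
      case inJ: True
      note a = absorb_optimal[OF assms(1-3) Suc.prems(1,2) u inJ]
      have "\<exists>y<2 ^ m. k \<le> card (fringe (search E n m y (absorb E n u c)))"
        using a Suc.prems by (intro Suc.IH valid_absorb u assms(3)) auto
      then obtain y where "y < 2 ^ m" "k \<le> card (fringe (search E n m y (absorb E n u c)))"
        by blast
      \<comment> \<open>The leading bit \<open>2 ^ m\<close> lets \<open>u\<close> join; the spent
        bit is balanced by the larger fringe.\<close>
      then show ?thesis using True by (intro exI[of _ "2 ^ m + y"]) (simp add: u_def)
    next
      case notJ: False
      \<comment> \<open>Here the spent bit is balanced by a new red vertex, while the fringe is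
        unchanged.\<close>
      have "red (c(u := 2)) = insert u (red c)" by (auto simp: red_def)
      moreover have "finite (red c)"
        using valid_finite(2)[OF Suc.prems(1)] by (rule finite_subset[rotated]) (auto simp: red_def fringe_def)
      moreover have "u \<notin> red c" "inner (c(u := 2)) = inner c" "fringe (c(u := 2)) = fringe c"
        using u by (auto simp: red_def inner_def fringe_def)
      ultimately have "\<exists>y<2 ^ m. k \<le> card (fringe (search E n m y (c(u := 2))))"
        using Suc.prems notJ by (intro Suc.IH valid_red u) (auto simp: consistent_def simp del: fun_upd_apply)
      then obtain y where "y < 2 ^ m" "k \<le> card (fringe (search E n m y (c(u := 2))))"
        by blast
      then show ?thesis using True by (intro exI[of _ y]) (simp add: u_def)
    qed
  qed
qed

lemma search_iff_rooted:
  assumes "E \<subseteq> {..<n} \<times> {..<n}"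
  shows "(\<exists>r<n. \<exists>y<2 ^ (2 * k). k \<le> card (fringe (search E n (2 * k) y (expand E r (\<lambda>_. 0))))) \<longleftrightarrow>
    (\<exists>r I. I \<subseteq> {..<n} \<and> rooted E r I \<and> k \<le> card (boundary E I))"
proof
  assume "\<exists>r<n. \<exists>y<2 ^ (2 * k). k \<le> card (fringe (search E n (2 * k) y (expand E r (\<lambda>_. 0))))"
  then obtain r y where "r < n" and
    le: "k \<le> card (fringe (search E n (2 * k) y (expand E r (\<lambda>_. 0))))" by blast
  let ?c = "search E n (2 * k) y (expand E r (\<lambda>_. 0))"
  have c: "valid E n r ?c" using valid_search valid_start \<open>r < n\<close> assms by blast
  then have "rooted E r (inner ?c)" "boundary E (inner ?c) = fringe ?c" by (auto simp: valid_def)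
  then show "\<exists>r I. I \<subseteq> {..<n} \<and> rooted E r I \<and> k \<le> card (boundary E I)"
    using le valid_finite(3)[OF c] by metis
next
  assume "\<exists>r I. I \<subseteq> {..<n} \<and> rooted E r I \<and> k \<le> card (boundary E I)"
  then obtain r I where I: "I \<subseteq> {..<n}" "rooted E r I" "k \<le> card (boundary E I)" by blast
  \<comment> \<open>The root is fixed before minimising, so that the run started at \<open>r\<close>
    can be compared with \<open>J\<close>. Finiteness is demanded because an infinite set has
    \<open>card\<close> 0 and would count as least.\<close>
  let ?P = "\<lambda>J. rooted E r J \<and> finite J \<and> k \<le> card (boundary E J)"
  have "?P I" using I finite_subset by auto
  then obtain J where J: "?P J" "\<And>J'. ?P J' \<Longrightarrow> card J \<le> card J'"
    using ex_has_least_nat[of ?P I card] by blast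
  then have opt: "optimal E r k J" by (auto simp: optimal_def)
  have r: "r < n" using I by (auto simp: rooted_def)
  have "inner (expand E r (\<lambda>_. 0)) = {r}" "red (expand E r (\<lambda>_. 0)) = {}"
    by (auto simp: inner_def red_def expand_def)
  then have "consistent J (expand E r (\<lambda>_. 0))" using J by (auto simp: consistent_def rooted_def)
  then show "\<exists>r<n. \<exists>y<2 ^ (2 * k). k \<le> card (fringe (search E n (2 * k) y (expand E r (\<lambda>_. 0))))"
    using search_complete[OF opt _ assms valid_start[OF r assms]] J r by auto
qed

section \<open>Reasoning about programs and their running time\<close>

primrec assigned :: "program \<Rightarrow> string set" where
  "assigned Skip = {}"
| "assigned (Assign x i e) = {x}"
| "assigned (Seq c1 c2) = assigned c1 \<union> assigned c2"
| "assigned (Cond b c1 c2) = assigned c1 \<union> assigned c2"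
| "assigned (While b c) = assigned c"

definition agree :: "string set \<Rightarrow> memory \<Rightarrow> memory \<Rightarrow> bool" where
  "agree W s s' \<longleftrightarrow> (\<forall>x. x \<notin> W \<longrightarrow> s' x = s x)"

lemma agreeD: "agree W s s' \<Longrightarrow> x \<notin> W \<Longrightarrow> s' x = s x"
  by (simp add: agree_def)

lemma exec_agree: "exec c s t s' \<Longrightarrow> agree (assigned c) s s'"
  by (induction rule: exec.induct) (auto simp: agree_def)

text \<open>A weakest precondition for total correctness; the postcondition also sees the exact running time.\<close>

definition wpt :: "program \<Rightarrow> (nat \<Rightarrow> memory \<Rightarrow> bool) \<Rightarrow> memory \<Rightarrow> bool" where
  "wpt c Q s \<longleftrightarrow> (\<exists>t s'. exec c s t s' \<and> Q t s')"

lemma wpt_Skip [simp]: "wpt Skip Q s \<longleftrightarrow> Q 1 s"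
  unfolding wpt_def using exec.Skip by (auto elim: SkipE)

lemma wpt_Assign [simp]: "wpt (Assign x i e) Q s \<longleftrightarrow>
    Q (1 + expr_cost i + expr_cost e) (s(x := (s x)(eval_expr i s := eval_expr e s)))"
  unfolding wpt_def
proof
  assume "\<exists>t s'. exec (Assign x i e) s t s' \<and> Q t s'"
  then show "Q (1 + expr_cost i + expr_cost e) (s(x := (s x)(eval_expr i s := eval_expr e s)))"
    by (auto elim: AssignE)
qed (use exec.Assign in blast)

lemma wpt_Seq [simp]: "wpt (Seq c1 c2) Q s \<longleftrightarrow>
    wpt c1 (\<lambda>t1 s1. wpt c2 (\<lambda>t2 s2. Q (t1 + t2) s2) s1) s"
  unfolding wpt_def by (blast elim: SeqE intro: exec.Seq)

lemma wpt_Cond [simp]: "wpt (Cond b c1 c2) Q s \<longleftrightarrow>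
    (if eval_expr b s \<noteq> 0 then wpt c1 (\<lambda>t. Q (1 + expr_cost b + t)) s
     else wpt c2 (\<lambda>t. Q (1 + expr_cost b + t)) s)"
proof (cases "eval_expr b s = 0")
  case True
  have "exec (Cond b c1 c2) s t s' \<longleftrightarrow> (\<exists>t2. t = 1 + expr_cost b + t2 \<and> exec c2 s t2 s')" for t s'
    using True exec.CondFalse[OF True] by (auto elim: CondE)
  then show ?thesis using True by (auto simp: wpt_def)
next
  case False
  have "exec (Cond b c1 c2) s t s' \<longleftrightarrow> (\<exists>t2. t = 1 + expr_cost b + t2 \<and> exec c1 s t2 s')" for t s'
    using False exec.CondTrue[OF False] by (auto elim: CondE)
  then show ?thesis using False by (auto simp: wpt_def)
qed

lemma wpt_While_False: "eval_expr b s = 0 \<Longrightarrow> Q (1 + expr_cost b) s \<Longrightarrow> wpt (While b c) Q s"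
  unfolding wpt_def using exec.WhileFalse by blast

lemma wpt_While_True:
  assumes "eval_expr b s \<noteq> 0"
    and "wpt c (\<lambda>t1 s1. wpt (While b c) (\<lambda>t2. Q (1 + expr_cost b + t1 + t2)) s1) s"
  shows "wpt (While b c) Q s"
  using assms unfolding wpt_def by (blast intro: exec.WhileTrue)

text \<open>The rule of consequence combined with the frame rule: specifications need to mention
  only what a program changes, and the rest is recovered from \<open>agree\<close>.\<close>

lemma wpt_mono: "wpt c Q s \<Longrightarrow> (\<And>t s'. Q t s' \<Longrightarrow> agree (assigned c) s s' \<Longrightarrow> Q' t s') \<Longrightarrow> wpt c Q' s"
  unfolding wpt_def using exec_agree by blast

section \<open>Counting loops and a test for equality with 1\<close>

abbreviation var :: "string \<Rightarrow> expr" where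
  "var x \<equiv> Cell x (Num 0)"

abbreviation set_var :: "string \<Rightarrow> expr \<Rightarrow> program" where
  "set_var x \<equiv> Assign x (Num 0)"

text \<open>By truncated subtraction the guard is nonzero exactly while the counter is below the
  value of \<open>e\<close>. That value is recomputed in each round, which is why
  \<open>wpt_For\<close> has the hypothesis \<open>bound\<close>.\<close>

definition For :: "string \<Rightarrow> expr \<Rightarrow> program \<Rightarrow> program" where
  "For i e body = Seq (set_var i (Num 0))
     (While (Minus e (var i)) (Seq body (set_var i (Plus (var i) (Num 1)))))"

lemma assigned_For [simp]: "assigned (For i e body) = insert i (assigned body)"
  by (auto simp: For_def)

text \<open>Each round costs \<open>expr_cost e + 4\<close> for the guard, at most \<open>T\<close>
  for the body and 6 for the increment. The initial assignment costs 3, and the failing guard once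
  more \<open>expr_cost e + 4\<close>.\<close>

lemma wpt_For:
  fixes P :: "nat \<Rightarrow> memory \<Rightarrow> bool"
  assumes init: "P 0 (s0(i := (s0 i)(0 := 0)))"
    and bound: "\<And>j s. j \<le> m \<Longrightarrow> P j s \<Longrightarrow> agree (insert i (assigned body)) s0 s \<Longrightarrow> eval_expr e s = m"
    and step: "\<And>j s. j < m \<Longrightarrow> P j s \<Longrightarrow> agree (insert i (assigned body)) s0 s \<Longrightarrow> s i 0 = j \<Longrightarrow>
      wpt body (\<lambda>t s'. t \<le> T \<and> P (Suc j) (s'(i := (s' i)(0 := Suc j)))) s"
    and "i \<notin> assigned body"
  shows "wpt (For i e body) (\<lambda>t s. t \<le> m * (expr_cost e + T + 10) + expr_cost e + 7 \<and> P m s) s0"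
proof -
  let ?b = "Minus e (var i)"
  let ?c = "Seq body (set_var i (Plus (var i) (Num 1)))"
  let ?A = "agree (insert i (assigned body)) s0"
  have loop: "wpt (While ?b ?c) (\<lambda>t s. t \<le> d * (expr_cost e + T + 10) + expr_cost e + 4 \<and> P m s) s"
    if "j + d = m" "P j s" "?A s" "s i 0 = j" for d j s
    using that
  proof (induction d arbitrary: j s)
    case 0
    then have "eval_expr e s = m" using bound by auto
    then show ?case using 0 by (intro wpt_While_False) auto
  next
    case (Suc d)
    have ev: "eval_expr e s = m" using bound[OF _ Suc.prems(2,3)] Suc.prems by simp
    show ?case
    proof (rule wpt_While_True)
      show "eval_expr ?b s \<noteq> 0" using ev Suc.prems by simp
      have st: "wpt body (\<lambda>t s'. t \<le> T \<and> P (Suc j) (s'(i := (s' i)(0 := Suc j)))) s"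
        using step[OF _ Suc.prems(2-4)] Suc.prems(1) by simp
      show "wpt ?c (\<lambda>t1 s1. wpt (While ?b ?c) (\<lambda>t2 s. 1 + expr_cost ?b + t1 + t2 \<le>
          Suc d * (expr_cost e + T + 10) + expr_cost e + 4 \<and> P m s) s1) s"
        unfolding wpt_Seq
      proof (rule wpt_mono[OF st])
        fix t s' assume a: "t \<le> T \<and> P (Suc j) (s'(i := (s' i)(0 := Suc j)))"
          and ag: "agree (assigned body) s s'"
        have [simp]: "s' i 0 = j" using ag assms(4) Suc.prems(4) by (simp add: agree_def)
        have "wpt (While ?b ?c) (\<lambda>t s. t \<le> d * (expr_cost e + T + 10) + expr_cost e + 4 \<and> P m s)
            (s'(i := (s' i)(0 := Suc j)))"
        proof (rule Suc.IH)
          show "?A (s'(i := (s' i)(0 := Suc j)))" using Suc.prems(3) ag by (auto simp: agree_def)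
          show "P (Suc j) (s'(i := (s' i)(0 := Suc j)))" using a by blast
        qed (use Suc.prems(1) in simp_all)
        then show "wpt (set_var i (Plus (var i) (Num 1))) (\<lambda>t2 s2. wpt (While ?b ?c)
            (\<lambda>t2a s. 1 + expr_cost ?b + (t + t2) + t2a \<le>
              Suc d * (expr_cost e + T + 10) + expr_cost e + 4 \<and> P m s) s2) s'"
          using a by (auto intro: wpt_mono)
      qed
    qed
  qed
  have "wpt (While ?b ?c) (\<lambda>t s. t \<le> m * (expr_cost e + T + 10) + expr_cost e + 4 \<and> P m s)
      (s0(i := (s0 i)(0 := 0)))"
    by (rule loop[of 0]) (use init in \<open>auto simp: agree_def\<close>)
  then show ?thesis unfolding For_def by (auto intro: wpt_mono)
qed

text \<open>The sum of the two truncated differences is the distance of \<open>e\<close> from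
  1.\<close>

definition is_one :: "expr \<Rightarrow> expr" where
  "is_one e = Minus (Num 1) (Plus (Minus e (Num 1)) (Minus (Num 1) e))"

lemma eval_is_one [simp]: "eval_expr (is_one e) s = (if eval_expr e s = 1 then 1 else 0)"
  by (auto simp: is_one_def)

lemma cost_is_one [simp]: "expr_cost (is_one e) = 2 * expr_cost e + 7"
  by (simp add: is_one_def)

section \<open>The program\<close>

text \<open>Of the fresh vertices only their number and the last one found are recorded; if the
  number is 1, this determines the vertex with which the chain continues.\<close>

definition expand_prog :: program where
  "expand_prog = Seq (Assign ''c'' (var ''u'') (Num 3)) (Seq (set_var ''cnt'' (Num 0))
     (For ''v'' (var ''n'')
       (Cond (Cell ''adj'' (Plus (Cell ''row'' (var ''u'')) (var ''v'')))
         (Cond (Cell ''c'' (var ''v'')) Skip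
           (Seq (Assign ''c'' (var ''v'') (Num 1))
             (Seq (set_var ''cnt'' (Plus (var ''cnt'') (Num 1))) (set_var ''last'' (var ''v'')))))
         Skip)))"

lemma assigned_expand_prog [simp]: "assigned expand_prog = {''c'', ''cnt'', ''v'', ''last''}"
  by (auto simp: expand_prog_def)

text \<open>Matrix rows are addressed through the table \<open>row\<close>, since the offset
  \<open>a * n\<close> cannot be computed by a multiplication.\<close>

definition represents :: "memory \<Rightarrow> (nat \<times> nat) set \<Rightarrow> nat \<Rightarrow> bool" where
  "represents s E n \<longleftrightarrow> s ''n'' 0 = n \<and> E \<subseteq> {..<n} \<times> {..<n} \<and>
     (\<forall>a<n. \<forall>b<n. s ''adj'' (s ''row'' a + b) \<noteq> 0 \<longleftrightarrow> (a, b) \<in> E)"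

lemma represents_agree:
  assumes "represents s E n" "agree W s s'" "''n'' \<notin> W" "''adj'' \<notin> W" "''row'' \<notin> W"
  shows "represents s' E n"
  using assms by (simp add: represents_def agree_def)

lemma finite_fresh: "E \<subseteq> {..<n} \<times> {..<n} \<Longrightarrow> finite (fresh E u c)"
  by (rule finite_subset[of _ "{..<n}"]) (auto simp: fresh_def)

lemma expand_prog_correct:
  assumes env: "represents s E n" and u: "s ''u'' 0 = u" "u < n"
  shows "wpt expand_prog (\<lambda>t s'. t \<le> 100 * (n + 1) \<and> s' ''c'' = expand E u (s ''c'') \<and>
    s' ''cnt'' 0 = card (fresh E u (s ''c'')) \<and>
    (card (fresh E u (s ''c'')) = 1 \<longrightarrow> s' ''last'' 0 = the_elem (fresh E u (s ''c'')))) s"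
proof -
  define c where "c = s ''c''"
  define F where "F j = fresh E u c \<inter> {..<j}" for j
  \<comment> \<open>A vertex other than \<open>u\<close> is recoloured only in its own round, so
    tests on the current colouring agree with tests on the initial one.\<close>
  define P where "P j s' \<longleftrightarrow>
      s' ''c'' = (\<lambda>v. if v = u then 3 else if v < j \<and> (u, v) \<in> E \<and> c v = 0 then 1 else c v) \<and>
      s' ''cnt'' 0 = card (F j) \<and> (card (F j) = 1 \<longrightarrow> F j = {s' ''last'' 0})" for j and s' :: memory
  have F_Suc: "F (Suc j) = (if j \<in> fresh E u c then insert j (F j) else F j)" for j
    by (auto simp: F_def lessThan_Suc)
  have fin: "finite (F j)" "j \<notin> F j" for j by (auto simp: F_def)
  let ?s = "s(''c'' := (s ''c'')(u := 3), ''cnt'' := (s ''cnt'')(0 := 0))"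
  let ?body = "Cond (Cell ''adj'' (Plus (Cell ''row'' (var ''u'')) (var ''v'')))
         (Cond (Cell ''c'' (var ''v'')) Skip
           (Seq (Assign ''c'' (var ''v'') (Num 1))
             (Seq (set_var ''cnt'' (Plus (var ''cnt'') (Num 1))) (set_var ''last'' (var ''v'')))))
         Skip"
  have loop: "wpt (For ''v'' (var ''n'') ?body)
      (\<lambda>t s. t \<le> n * (expr_cost (var ''n'') + 50 + 10) + expr_cost (var ''n'') + 7 \<and> P n s) ?s"
  proof (rule wpt_For)
    show "P 0 (?s(''v'' := (?s ''v'')(0 := 0)))"
      by (auto simp: P_def F_def c_def)
  next
    fix j s' assume j: "j < n" and P: "P j s'"
      and ag: "agree (insert ''v'' (assigned ?body)) ?s s'" and v: "s' ''v'' 0 = j"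
    have adj: "s' ''adj'' (s' ''row'' (s' ''u'' 0) + j) \<noteq> 0 \<longleftrightarrow> (u, j) \<in> E"
      using ag env u j by (simp add: agree_def represents_def)
    show "wpt ?body (\<lambda>t s'. t \<le> 50 \<and> P (Suc j) (s'(''v'' := (s' ''v'')(0 := Suc j)))) s'"
      using P fin[of j] adj v
      by (auto simp: P_def F_Suc fresh_def less_Suc_eq fun_eq_iff)
  qed (use env in \<open>auto simp: agree_def represents_def\<close>)
  \<comment> \<open>The 7 units pay for the two assignments before the loop, which cost 4 and
    3.\<close>
  have "wpt (For ''v'' (var ''n'') ?body) (\<lambda>t s'. 7 + t \<le> 100 * (n + 1) \<and> s' ''c'' = expand E u c \<and>
    s' ''cnt'' 0 = card (fresh E u c) \<and>
    (card (fresh E u c) = 1 \<longrightarrow> s' ''last'' 0 = the_elem (fresh E u c))) ?s"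
  proof (rule wpt_mono[OF loop])
    fix t s'
    assume a: "t \<le> n * (expr_cost (var ''n'') + 50 + 10) + expr_cost (var ''n'') + 7 \<and> P n s'"
    have "F n = fresh E u c" using env by (auto simp: F_def fresh_def represents_def)
    moreover have "s' ''c'' = expand E u c"
      using a env by (auto simp: P_def expand_def fun_eq_iff represents_def)
    ultimately show "7 + t \<le> 100 * (n + 1) \<and> s' ''c'' = expand E u c \<and>
      s' ''cnt'' 0 = card (fresh E u c) \<and>
      (card (fresh E u c) = 1 \<longrightarrow> s' ''last'' 0 = the_elem (fresh E u c))"
      using a by (auto simp: P_def)
  qed
  then show ?thesis by (simp add: expand_prog_def u c_def)
qed

definition tracks :: "memory \<Rightarrow> colouring \<times> nat set \<Rightarrow> bool" where
  "tracks s p \<longleftrightarrow> s ''c'' = fst p \<and> s ''cnt'' 0 = card (snd p) \<and>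
     (card (snd p) = 1 \<longrightarrow> s ''last'' 0 = the_elem (snd p))"

definition chain_prog :: program where
  "chain_prog = Cond (is_one (var ''cnt'')) (Seq (set_var ''u'' (var ''last'')) expand_prog) Skip"

lemma assigned_chain_prog [simp]: "assigned chain_prog = {''c'', ''cnt'', ''v'', ''last'', ''u''}"
  by (auto simp: chain_prog_def)

lemma chain_prog_correct:
  assumes env: "represents s E n" and p: "tracks s p" "snd p \<subseteq> {..<n}"
  shows "wpt chain_prog (\<lambda>t s'. t \<le> 100 * (n + 1) + 20 \<and> tracks s' (chain E p)) s"
proof (cases "card (snd p) = 1")
  case True
  let ?u = "the_elem (snd p)"
  let ?s = "s(''u'' := (s ''u'')(0 := ?u))"
  have "?u < n" using p card_1_the_elem[OF True] by blast
  moreover have "represents ?s E n" using env by (simp add: represents_def)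
  moreover have "?s ''u'' 0 = ?u" by simp
  \<comment> \<open>The branch costs 12 and the assignment to \<open>u\<close> costs 4, together
    16.\<close>
  ultimately have "wpt expand_prog (\<lambda>t s'. 16 + t \<le> 100 * (n + 1) + 20 \<and> tracks s' (chain E p)) ?s"
    by (intro wpt_mono[OF expand_prog_correct])
      (use p True in \<open>auto simp: tracks_def chain_def split_beta\<close>)
  then show ?thesis using True p by (simp add: chain_prog_def tracks_def)
next
  case False
  then show ?thesis using p by (simp add: chain_prog_def chain_def tracks_def split_beta)
qed

definition absorb_prog :: program where
  "absorb_prog = Seq expand_prog (For ''j'' (var ''n'') chain_prog)"

lemma assigned_absorb_prog [simp]:
  "assigned absorb_prog = {''c'', ''cnt'', ''v'', ''last'', ''u'', ''j''}"
  by (auto simp: absorb_prog_def)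

lemma chain_bounded:
  assumes "E \<subseteq> {..<n} \<times> {..<n}"
  shows "snd ((chain E ^^ j) (expand E u c, fresh E u c)) \<subseteq> {..<n}"
proof (induction j)
  case 0
  then show ?case using assms by (auto simp: fresh_def)
next
  case (Suc j)
  have "snd (chain E p) \<subseteq> {..<n}" if "snd p \<subseteq> {..<n}" for p
    using that assms by (auto simp: chain_def fresh_def split_beta split: if_splits)
  then show ?case using Suc by simp
qed

lemma absorb_prog_correct:
  assumes env: "represents s E n" and u: "s ''u'' 0 = u" "u < n"
  shows "wpt absorb_prog (\<lambda>t s'. t \<le> 300 * (n + 1)\<^sup>2 \<and> s' ''c'' = absorb E n u (s ''c'')) s"
proof -
  define p where "p = (expand E u (s ''c''), fresh E u (s ''c''))"
  have E: "E \<subseteq> {..<n} \<times> {..<n}" using env by (simp add: represents_def)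
  have loop: "wpt (For ''j'' (var ''n'') chain_prog) (\<lambda>t s'. t \<le> n * (expr_cost (var ''n'') +
        (100 * (n + 1) + 20) + 10) + expr_cost (var ''n'') + 7 \<and> tracks s' ((chain E ^^ n) p)) s1"
    if s1: "tracks s1 p" "represents s1 E n" for s1
  proof (rule wpt_For[where P = "\<lambda>j s'. tracks s' ((chain E ^^ j) p)"])
    show "tracks (s1(''j'' := (s1 ''j'')(0 := 0))) ((chain E ^^ 0) p)"
      using s1 by (simp add: tracks_def)
  next
    fix j s' assume tr: "tracks s' ((chain E ^^ j) p)"
      and ag: "agree (insert ''j'' (assigned chain_prog)) s1 s'"
    have "represents s' E n" by (rule represents_agree[OF s1(2) ag]) auto
    from chain_prog_correct[OF this tr] chain_bounded[OF E]
    have "wpt chain_prog (\<lambda>t s'. t \<le> 100 * (n + 1) + 20 \<and> tracks s' (chain E ((chain E ^^ j) p))) s'"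
      by (simp add: p_def)
    then show "wpt chain_prog (\<lambda>t s'. t \<le> 100 * (n + 1) + 20 \<and>
        tracks (s'(''j'' := (s' ''j'')(0 := Suc j))) ((chain E ^^ Suc j) p)) s'"
      by (rule wpt_mono) (simp add: tracks_def)
  qed (use s1 in \<open>auto simp: agree_def represents_def\<close>)
  show ?thesis
    unfolding absorb_prog_def wpt_Seq
  proof (rule wpt_mono[OF expand_prog_correct[OF env u]], elim conjE)
    fix t s1
    assume s1: "t \<le> 100 * (n + 1)" "s1 ''c'' = expand E u (s ''c'')"
      "s1 ''cnt'' 0 = card (fresh E u (s ''c''))"
      "card (fresh E u (s ''c'')) = 1 \<longrightarrow> s1 ''last'' 0 = the_elem (fresh E u (s ''c''))"
      and ag: "agree (assigned expand_prog) s s1"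
    have "represents s1 E n" by (rule represents_agree[OF env ag]) auto
    moreover have "tracks s1 p" using s1 by (simp add: tracks_def p_def)
    ultimately show "wpt (For ''j'' (var ''n'') chain_prog) (\<lambda>t2 s2. t + t2 \<le> 300 * (n + 1)\<^sup>2 \<and>
        s2 ''c'' = absorb E n u (s ''c'')) s1"
      by (intro wpt_mono[OF loop])
        (use s1(1) in \<open>auto simp: tracks_def absorb_def p_def power2_eq_square algebra_simps\<close>)
  qed
qed

section \<open>One decision, and the sequence of decisions of one bit string\<close>

definition pick_prog :: program where
  "pick_prog = Seq (set_var ''u'' (var ''n''))
     (For ''v'' (var ''n'') (Cond (is_one (Cell ''c'' (var ''v''))) (set_var ''u'' (var ''v'')) Skip))"

lemma assigned_pick_prog [simp]: "assigned pick_prog = {''u'', ''v''}"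
  by (auto simp: pick_prog_def)

text \<open>A scan that overwrites its result keeps the largest hit, in accordance with the
  \<open>Max\<close> in \<open>search\<close>. The default \<open>n\<close> signals that no vertex
  is undecided; \<open>step_prog\<close> recognises it by \<open>n - u\<close> being 0.\<close>

definition last_blue :: "nat \<Rightarrow> colouring \<Rightarrow> nat \<Rightarrow> nat" where
  "last_blue n c j = (if \<exists>v<j. c v = 1 then Max {v. v < j \<and> c v = 1} else n)"

lemma last_blue_Suc: "last_blue n c (Suc j) = (if c j = 1 then j else last_blue n c j)"
proof (cases "c j = 1")
  case True
  have "finite {v. v < Suc j \<and> c v = 1}" by (rule finite_subset[of _ "{..<Suc j}"]) auto
  then have "Max {v. v < Suc j \<and> c v = 1} = j" using True by (intro Max_eqI) auto
  then show ?thesis using True by (auto simp: last_blue_def)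
next
  case False
  have "v < Suc j \<and> c v = 1 \<longleftrightarrow> v < j \<and> c v = 1" for v using False by (auto simp: less_Suc_eq)
  then show ?thesis using False unfolding last_blue_def by presburger
qed

lemma pick_prog_correct:
  assumes "s ''n'' 0 = n"
  shows "wpt pick_prog (\<lambda>t s'. t \<le> 100 * (n + 1) \<and> s' ''u'' 0 = last_blue n (s ''c'') n) s"
proof -
  let ?s = "s(''u'' := (s ''u'')(0 := n))"
  let ?body = "Cond (is_one (Cell ''c'' (var ''v''))) (set_var ''u'' (var ''v'')) Skip"
  have "wpt (For ''v'' (var ''n'') ?body) (\<lambda>t s'. t \<le> n * (expr_cost (var ''n'') + 50 + 10) +
      expr_cost (var ''n'') + 7 \<and> s' ''u'' 0 = last_blue n (s ''c'') n) ?s"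
  proof (rule wpt_For[where P = "\<lambda>j s'. s' ''u'' 0 = last_blue n (s ''c'') j"])
    fix j s' assume "s' ''u'' 0 = last_blue n (s ''c'') j" "s' ''v'' 0 = j"
      and ag: "agree (insert ''v'' (assigned ?body)) ?s s'"
    then show "wpt ?body (\<lambda>t s'. t \<le> 50 \<and>
        (s'(''v'' := (s' ''v'')(0 := Suc j))) ''u'' 0 = last_blue n (s ''c'') (Suc j)) s'"
      using agreeD[OF ag, of "''c''"] by (simp add: last_blue_Suc)
  qed (use assms in \<open>auto simp: agree_def last_blue_def\<close>)
  then have "wpt (For ''v'' (var ''n'') ?body) (\<lambda>t s'. 4 + t \<le> 100 * (n + 1) \<and>
      s' ''u'' 0 = last_blue n (s ''c'') n) ?s"
    by (rule wpt_mono) auto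
  then show ?thesis by (simp add: pick_prog_def assms)
qed

text \<open>The 1 added to \<open>y\<close> makes the truncated difference nonzero also for
  \<open>y = 2 ^ i\<close>, so the guard tests \<open>2 ^ i \<le> y\<close>.\<close>

definition step_prog :: program where
  "step_prog = Seq pick_prog (Cond (Minus (var ''n'') (var ''u''))
     (Cond (Minus (Plus (var ''y'') (Num 1)) (Cell ''pw'' (var ''i'')))
       (Seq (set_var ''y'' (Minus (var ''y'') (Cell ''pw'' (var ''i'')))) absorb_prog)
       (Assign ''c'' (var ''u'') (Num 2)))
     Skip)"

lemma assigned_step_prog [simp]:
  "assigned step_prog = {''c'', ''cnt'', ''v'', ''last'', ''u'', ''j'', ''y''}"
  by (auto simp: step_prog_def)

text \<open>Since \<open>search\<close> is tail recursive, a step is specified by the result that is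
  still to be computed. This covers all three branches at once and makes the surrounding loop a
  chain of equations.\<close>

lemma step_prog_correct:
  assumes env: "represents s E n" and i: "s ''i'' 0 = i" "s ''pw'' i = 2 ^ i"
  shows "wpt step_prog (\<lambda>t s'. t \<le> 500 * (n + 1)\<^sup>2 \<and>
    search E n i (s' ''y'' 0) (s' ''c'') = search E n (Suc i) (s ''y'' 0) (s ''c'')) s"
proof -
  let ?Q = "\<lambda>t s'. t \<le> 500 * (n + 1)\<^sup>2 \<and>
    search E n i (s' ''y'' 0) (s' ''c'') = search E n (Suc i) (s ''y'' 0) (s ''c'')"
  have n: "s ''n'' 0 = n" using env by (simp add: represents_def)
  have sq: "100 * n + d \<le> 200 * (n + 1)\<^sup>2" if "d \<le> 200" for d
    using that by (simp add: power2_eq_square algebra_simps)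
  show ?thesis
    unfolding step_prog_def wpt_Seq
  proof (rule wpt_mono[OF pick_prog_correct[of s, OF n]], elim conjE)
    fix t s1
    assume t: "t \<le> 100 * (n + 1)" and u: "s1 ''u'' 0 = last_blue n (s ''c'') n"
      and ag: "agree (assigned pick_prog) s s1"
    have s1: "s1 ''n'' 0 = n" "s1 ''y'' = s ''y''" "s1 ''pw'' = s ''pw''" "s1 ''i'' 0 = i"
      "s1 ''c'' = s ''c''" "represents s1 E n"
      using ag n i represents_agree[OF env ag] by (auto simp: agree_def)
    show "wpt (Cond (Minus (var ''n'') (var ''u''))
     (Cond (Minus (Plus (var ''y'') (Num 1)) (Cell ''pw'' (var ''i'')))
       (Seq (set_var ''y'' (Minus (var ''y'') (Cell ''pw'' (var ''i'')))) absorb_prog)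
       (Assign ''c'' (var ''u'') (Num 2))) Skip) (\<lambda>t2 s2. ?Q (t + t2) s2) s1"
    proof (cases "\<exists>v<n. s ''c'' v = 1")
      case False
      then have "s1 ''u'' 0 = n" using u by (auto simp: last_blue_def)
      moreover have "search E n (Suc i) (s ''y'' 0) (s ''c'') = search E n i (s ''y'' 0) (s ''c'')"
        using False by (simp only: search.simps if_False)
      ultimately show ?thesis using s1 t sq[of 110] by simp
    next
      case True
      define w where "w = Max {v. v < n \<and> s ''c'' v = 1}"
      have uw: "s1 ''u'' 0 = w" using u True by (simp add: last_blue_def w_def)
      have w: "w < n" "s ''c'' w = 1" using Max_blue[OF True] by (auto simp: w_def)
      have search: "search E n (Suc i) (s ''y'' 0) (s ''c'') =
        (if 2 ^ i \<le> s ''y'' 0 then search E n i (s ''y'' 0 - 2 ^ i) (absorb E n w (s ''c''))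
         else search E n i (s ''y'' 0) ((s ''c'')(w := 2)))"
        using True by (simp only: search.simps if_True Let_def w_def)
      show ?thesis
      proof (cases "2 ^ i \<le> s ''y'' 0")
        case le: True
        let ?s = "s1(''y'' := (s ''y'')(0 := s ''y'' 0 - 2 ^ i))"
        have "represents ?s E n" "?s ''u'' 0 = w"
          using s1 uw by (simp_all add: represents_def)
        \<comment> \<open>The two guards and the update of \<open>y\<close> cost 6, 9 and 8; the
          allowance of 30 covers this.\<close>
        then have "wpt absorb_prog (\<lambda>t2 s2. ?Q (t + (30 + t2)) s2) ?s"
        proof (rule wpt_mono[OF absorb_prog_correct[of ?s, OF _ _ w(1)]], elim conjE)
          fix t2 s2
          assume "t2 \<le> 300 * (n + 1)\<^sup>2" "s2 ''c'' = absorb E n w (?s ''c'')"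
            "agree (assigned absorb_prog) ?s s2"
          then show "?Q (t + (30 + t2)) s2"
            using t sq[of 130] s1 le unfolding search by (simp add: agree_def)
        qed
        then show ?thesis
          using s1 i uw w le by (simp del: search.simps) (erule wpt_mono, simp)
      next
        case False
        then show ?thesis
          using s1 i uw w t sq[of 120] unfolding search by (simp del: search.simps)
      qed
    qed
  qed
qed

text \<open>The decrement precedes the step, so that \<open>i\<close> is the exponent of the bit
  being decided, as in the \<open>Suc i\<close> equation of \<open>search\<close>.\<close>

definition search_prog :: program where
  "search_prog = Seq (set_var ''i'' (Plus (var ''k'') (var ''k'')))
     (While (var ''i'') (Seq (set_var ''i'' (Minus (var ''i'') (Num 1))) step_prog))"

lemma assigned_search_prog [simp]:
  "assigned search_prog = {''c'', ''cnt'', ''v'', ''last'', ''u'', ''j'', ''y'', ''i''}"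
  by (auto simp: search_prog_def)

lemma search_loop_correct:
  assumes "represents s E n" "s ''i'' 0 = m" "\<forall>i<m. s ''pw'' i = 2 ^ i"
  shows "wpt (While (var ''i'') (Seq (set_var ''i'' (Minus (var ''i'') (Num 1))) step_prog))
    (\<lambda>t s'. t \<le> m * (500 * (n + 1)\<^sup>2 + 20) + 3 \<and> s' ''c'' = search E n m (s ''y'' 0) (s ''c'')) s"
  using assms
proof (induction m arbitrary: s)
  case 0
  then show ?case by (intro wpt_While_False) auto
next
  case (Suc m)
  let ?s = "s(''i'' := (s ''i'')(0 := m))"
  let ?W = "While (var ''i'') (Seq (set_var ''i'' (Minus (var ''i'') (Num 1))) step_prog)"
  let ?Q = "\<lambda>t s'. t \<le> Suc m * (500 * (n + 1)\<^sup>2 + 20) + 3 \<and>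
    s' ''c'' = search E n (Suc m) (s ''y'' 0) (s ''c'')"
  have "represents ?s E n" "?s ''i'' 0 = m" "?s ''pw'' m = 2 ^ m"
    using Suc.prems by (simp_all add: represents_def)
  then have "wpt step_prog (\<lambda>t1 s1. wpt ?W (\<lambda>t2 s2. ?Q (20 + t1 + t2) s2) s1) ?s"
  proof (rule wpt_mono[OF step_prog_correct], elim conjE)
    fix t1 s1
    assume t1: "t1 \<le> 500 * (n + 1)\<^sup>2"
      and se: "search E n m (s1 ''y'' 0) (s1 ''c'') = search E n (Suc m) (?s ''y'' 0) (?s ''c'')"
      and ag: "agree (assigned step_prog) ?s s1"
    have "represents s1 E n"
      by (rule represents_agree[OF \<open>represents ?s E n\<close> ag]) auto
    moreover have "s1 ''i'' 0 = m" "\<forall>i<m. s1 ''pw'' i = 2 ^ i"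
      using ag Suc.prems(3) by (auto simp: agree_def)
    ultimately show "wpt ?W (\<lambda>t2 s2. ?Q (20 + t1 + t2) s2) s1"
    proof (rule wpt_mono[OF Suc.IH], elim conjE, intro conjI)
      fix t2 s2
      assume "t2 \<le> m * (500 * (n + 1)\<^sup>2 + 20) + 3"
      then show "20 + t1 + t2 \<le> Suc m * (500 * (n + 1)\<^sup>2 + 20) + 3"
        using t1 unfolding mult_Suc by linarith
      assume "s2 ''c'' = search E n m (s1 ''y'' 0) (s1 ''c'')"
      then show "s2 ''c'' = search E n (Suc m) (s ''y'' 0) (s ''c'')" using se by simp
    qed
  qed
  then have "wpt step_prog (\<lambda>t1 s1. wpt ?W (\<lambda>t2 s2. ?Q (3 + (6 + t1) + t2) s2) s1) ?s"
    by (rule wpt_mono) (erule wpt_mono, simp)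
  then show ?case
    using Suc.prems(2) by (intro wpt_While_True) (simp_all del: search.simps)
qed

section \<open>Evaluating one pair of root and bit string\<close>

definition count_prog :: program where
  "count_prog = Seq (set_var ''m'' (Num 0)) (Seq
     (For ''v'' (var ''n'') (Cond (Cell ''c'' (var ''v''))
        (Cond (Minus (Num 3) (Cell ''c'' (var ''v''))) (set_var ''m'' (Plus (var ''m'') (Num 1))) Skip) Skip))
     (Cond (Minus (Plus (var ''m'') (Num 1)) (var ''k'')) (set_var ''out'' (Num 1)) Skip))"

lemma assigned_count_prog [simp]: "assigned count_prog = {''m'', ''v'', ''out''}"
  by (auto simp: count_prog_def)

text \<open>On failure \<open>out\<close> keeps its old value, so that repeated attempts accumulate
  the disjunction of their outcomes.\<close>

lemma count_prog_correct:
  assumes c: "valid E n r (s ''c'')" and n: "s ''n'' 0 = n"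
  shows "wpt count_prog (\<lambda>t s'. t \<le> 200 * (n + 1) \<and>
    s' ''out'' 0 = (if s ''k'' 0 \<le> card (fringe (s ''c'')) then 1 else s ''out'' 0)) s"
proof -
  define F where "F j = fringe (s ''c'') \<inter> {..<j}" for j
  let ?s = "s(''m'' := (s ''m'')(0 := 0))"
  let ?body = "Cond (Cell ''c'' (var ''v''))
    (Cond (Minus (Num 3) (Cell ''c'' (var ''v''))) (set_var ''m'' (Plus (var ''m'') (Num 1))) Skip) Skip"
  have F_Suc: "F (Suc j) = (if j \<in> fringe (s ''c'') then insert j (F j) else F j)" for j
    by (auto simp: F_def lessThan_Suc)
  have fin: "finite (F j)" "j \<notin> F j" for j by (auto simp: F_def)
  have loop: "wpt (For ''v'' (var ''n'') ?body) (\<lambda>t s'. t \<le> n * (expr_cost (var ''n'') + 50 + 10) +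
      expr_cost (var ''n'') + 7 \<and> s' ''m'' 0 = card (F n)) ?s"
  proof (rule wpt_For[where P = "\<lambda>j s'. s' ''m'' 0 = card (F j)"])
    fix j s' assume m: "s' ''m'' 0 = card (F j)" and v: "s' ''v'' 0 = j"
      and ag: "agree (insert ''v'' (assigned ?body)) ?s s'"
    have [simp]: "s' ''c'' = s ''c''" using ag by (simp add: agree_def)
    have "s ''c'' j = 0 \<or> s ''c'' j = 1 \<or> s ''c'' j = 2 \<or> s ''c'' j = 3"
      using c by (simp add: valid_def le3_cases)
    then show "wpt ?body (\<lambda>t s'. t \<le> 50 \<and>
        (s'(''v'' := (s' ''v'')(0 := Suc j))) ''m'' 0 = card (F (Suc j))) s'"
      using m v fin[of j] by (auto simp: F_Suc fringe_def)
  qed (use n in \<open>auto simp: agree_def F_def\<close>)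
  have "F n = fringe (s ''c'')" using valid_lt[OF c] by (auto simp: F_def fringe_def)
  then have "wpt (For ''v'' (var ''n'') ?body) (\<lambda>t s'. t \<le> 100 * (n + 1) \<and>
      s' ''m'' 0 = card (fringe (s ''c'')) \<and> s' ''k'' = s ''k'' \<and> s' ''out'' = s ''out'') ?s"
    by (intro wpt_mono[OF loop]) (auto simp: agree_def)
  then show ?thesis
    unfolding count_prog_def by simp (intro conjI impI; erule wpt_mono; auto)
qed

definition reset_prog :: program where
  "reset_prog = For ''v'' (var ''n'') (Assign ''c'' (var ''v'') (Num 0))"

lemma assigned_reset_prog [simp]: "assigned reset_prog = {''v'', ''c''}"
  by (auto simp: reset_prog_def)

lemma reset_prog_correct:
  assumes n: "s ''n'' 0 = n" and c: "\<And>v. n \<le> v \<Longrightarrow> s ''c'' v = 0"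
  shows "wpt reset_prog (\<lambda>t s'. t \<le> 100 * (n + 1) \<and> s' ''c'' = (\<lambda>_. 0)) s"
proof -
  let ?body = "Assign ''c'' (var ''v'') (Num 0)"
  have "wpt (For ''v'' (var ''n'') ?body) (\<lambda>t s'. t \<le> n * (expr_cost (var ''n'') + 50 + 10) +
      expr_cost (var ''n'') + 7 \<and> s' ''c'' = (\<lambda>v. if v < n then 0 else s ''c'' v)) s"
  proof (rule wpt_For[where P = "\<lambda>j s'. s' ''c'' = (\<lambda>v. if v < j then 0 else s ''c'' v)"])
    fix j s' assume "s' ''c'' = (\<lambda>v. if v < j then 0 else s ''c'' v)" "s' ''v'' 0 = j"
    then show "wpt ?body (\<lambda>t s'. t \<le> 50 \<and> (s'(''v'' := (s' ''v'')(0 := Suc j))) ''c'' =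
        (\<lambda>v. if v < Suc j then 0 else s ''c'' v)) s'"
      by (auto simp: fun_eq_iff less_Suc_eq)
  qed (use n in \<open>auto simp: agree_def\<close>)
  then show ?thesis unfolding reset_prog_def
    by (rule wpt_mono) (use c in \<open>auto simp: fun_eq_iff\<close>)
qed

text \<open>The search consumes the copy \<open>y\<close>, while \<open>x\<close> survives as the
  counter of the enclosing loop.\<close>

definition try_prog :: program where
  "try_prog = Seq reset_prog (Seq (set_var ''u'' (var ''r'')) (Seq expand_prog
     (Seq (set_var ''y'' (var ''x'')) (Seq search_prog count_prog))))"

lemma assigned_try_prog [simp]: "assigned try_prog =
    {''c'', ''cnt'', ''v'', ''last'', ''u'', ''j'', ''y'', ''i'', ''m'', ''out''}"
  by (auto simp: try_prog_def)

definition succeeds :: "(nat \<times> nat) set \<Rightarrow> nat \<Rightarrow> nat \<Rightarrow> nat \<Rightarrow> nat \<Rightarrow> bool" where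
  "succeeds E n k r x \<longleftrightarrow> k \<le> card (fringe (search E n (2 * k) x (expand E r (\<lambda>_. 0))))"

text \<open>The pieces are verified from the last to the first; each intermediate fact takes the
  time \<open>t\<close> spent so far as a parameter and ends in the same postcondition
  \<open>Q\<close>.\<close>

lemma try_prog_correct:
  assumes env: "represents s E n" and c: "\<And>v. n \<le> v \<Longrightarrow> s ''c'' v = 0"
    and r: "s ''r'' 0 = r" "r < n" and x: "s ''x'' 0 = x" and k: "s ''k'' 0 = k"
    and pw: "\<And>i. i < 2 * k \<Longrightarrow> s ''pw'' i = 2 ^ i"
  shows "wpt try_prog (\<lambda>t s'. t \<le> 2000 * ((n + 1)\<^sup>2 * (k + 1)) \<and> (\<forall>v\<ge>n. s' ''c'' v = 0) \<and>
    s' ''out'' 0 = (if succeeds E n k r x then 1 else s ''out'' 0)) s"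
proof -
  let ?W = "{''c'', ''cnt'', ''v'', ''last'', ''u'', ''j'', ''y'', ''i''}"
  let ?c = "search E n (2 * k) x (expand E r (\<lambda>_. 0))"
  define Q where "Q t s' \<longleftrightarrow> t \<le> 2000 * ((n + 1)\<^sup>2 * (k + 1)) \<and> (\<forall>v\<ge>n. s' ''c'' v = 0) \<and>
    s' ''out'' 0 = (if succeeds E n k r x then 1 else s ''out'' 0)" for t and s' :: memory
  have n: "s ''n'' 0 = n" using env by (simp add: represents_def)
  have E: "E \<subseteq> {..<n} \<times> {..<n}" using env by (simp add: represents_def)
  have valid: "valid E n r ?c" using valid_search valid_start r E by blast
  have count: "wpt count_prog (\<lambda>t2 s2. Q (t + t2) s2) s'"
    if t: "t \<le> 200 * (n + 1) + 2 * k * (500 * (n + 1)\<^sup>2 + 20) + 30"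
      and s': "s' ''c'' = ?c" "agree ?W s s'" for t s'
  proof -
    have "t + 200 * (n + 1) \<le> 2000 * ((n + 1)\<^sup>2 * (k + 1))"
    proof -
      \<comment> \<open>Naming the square and its product with \<open>k\<close> makes the estimate
        linear.\<close>
      define q where "q = (n + 1)\<^sup>2"
      define z where "z = k * q"
      have "1 \<le> q" "n \<le> q"
        by (simp_all add: q_def power2_eq_square)
      moreover have "k \<le> z" using \<open>1 \<le> q\<close> by (simp add: z_def)
      moreover have "t \<le> 200 * n + 1000 * z + 40 * k + 230"
        using t unfolding q_def[symmetric] z_def by (simp add: algebra_simps)
      ultimately have "t + 200 * n + 200 \<le> 2000 * z + 2000 * q" by linarith
      then show ?thesis unfolding q_def[symmetric] z_def by (simp add: algebra_simps)
    qed
    moreover have "s' ''n'' 0 = n" "s' ''k'' 0 = k" "s' ''out'' = s ''out''"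
      using s'(2) n k by (auto simp: agree_def)
    ultimately show ?thesis
      using valid s'(1) unfolding Q_def succeeds_def
      by (intro wpt_mono[OF count_prog_correct[of E n r]])
        (auto simp: agree_def valid_def)
  qed
  have search: "wpt search_prog (\<lambda>t2 s2. wpt count_prog (\<lambda>t3 s3. Q (t + (t2 + t3)) s3) s2) s'"
    if t: "t \<le> 200 * (n + 1) + 20"
      and s': "s' ''c'' = expand E r (\<lambda>_. 0)" "s' ''y'' 0 = x" "agree ?W s s'" for t s'
  proof -
    let ?s = "s'(''i'' := (s' ''i'')(0 := 2 * k))"
    let ?L = "While (var ''i'') (Seq (set_var ''i'' (Minus (var ''i'') (Num 1))) step_prog)"
    have "represents ?s E n" "?s ''i'' 0 = 2 * k" "\<forall>i<2 * k. ?s ''pw'' i = 2 ^ i"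
      using env s'(3) pw by (auto simp: represents_def agree_def)
    then have "wpt ?L (\<lambda>t2 s2. wpt count_prog (\<lambda>t3 s3. Q (t + 7 + t2 + t3) s3) s2) ?s"
    proof (rule wpt_mono[OF search_loop_correct], elim conjE)
      fix t2 s2
      assume "t2 \<le> 2 * k * (500 * (n + 1)\<^sup>2 + 20) + 3"
        "s2 ''c'' = search E n (2 * k) (?s ''y'' 0) (?s ''c'')" and ag: "agree (assigned ?L) ?s s2"
      then show "wpt count_prog (\<lambda>t3 s3. Q (t + 7 + t2 + t3) s3) s2"
        using t s' by (intro count) (auto simp: agree_def)
    qed
    moreover have "s' ''k'' 0 = k" using s'(3) k by (simp add: agree_def)
    ultimately show ?thesis
      by (simp add: search_prog_def mult_2[symmetric]) (erule wpt_mono, erule wpt_mono, simp add: Q_def)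
  qed
  have expand: "wpt expand_prog (\<lambda>t2 s2. wpt (Seq (set_var ''y'' (var ''x'')) (Seq search_prog count_prog))
      (\<lambda>t3 s3. Q (t + (t2 + t3)) s3) s2) s'"
    if t: "t \<le> 100 * (n + 1) + 10" and s': "s' ''c'' = (\<lambda>_. 0)" "s' ''u'' 0 = r" "agree ?W s s'" for t s'
  proof (rule wpt_mono[OF expand_prog_correct[OF represents_agree[OF env s'(3)] s'(2) r(2)]];
      (elim conjE)?)
    fix t2 s2
    assume t2: "t2 \<le> 100 * (n + 1)" and s2: "s2 ''c'' = expand E r (s' ''c'')"
      and ag: "agree (assigned expand_prog) s' s2"
    have "s2 ''x'' 0 = x" using s'(3) ag x by (simp add: agree_def)
    moreover have "wpt search_prog (\<lambda>t3 s3. wpt count_prog (\<lambda>t4 s4. Q (t + t2 + 4 + (t3 + t4)) s4) s3)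
        (s2(''y'' := (s2 ''y'')(0 := x)))"
      using t t2 s2 s' ag by (intro search) (auto simp: agree_def)
    ultimately show "wpt (Seq (set_var ''y'' (var ''x'')) (Seq search_prog count_prog))
      (\<lambda>t3 s3. Q (t + (t2 + t3)) s3) s2"
      by simp (erule wpt_mono, erule wpt_mono, simp add: Q_def)
  qed simp_all
  have "wpt reset_prog (\<lambda>t1 s1. wpt (Seq (set_var ''u'' (var ''r'')) (Seq expand_prog
     (Seq (set_var ''y'' (var ''x'')) (Seq search_prog count_prog)))) (\<lambda>t2 s2. Q (t1 + t2) s2) s1) s"
  proof (rule wpt_mono[OF reset_prog_correct[of s, OF n c]], assumption, elim conjE)
    fix t1 s1
    assume t1: "t1 \<le> 100 * (n + 1)" and s1: "s1 ''c'' = (\<lambda>_. 0)" and ag: "agree (assigned reset_prog) s s1"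
    have "s1 ''r'' 0 = r" using ag r by (simp add: agree_def)
    moreover have "wpt expand_prog (\<lambda>t2 s2. wpt (Seq (set_var ''y'' (var ''x'')) (Seq search_prog count_prog))
      (\<lambda>t3 s3. Q (t1 + 4 + (t2 + t3)) s3) s2) (s1(''u'' := (s1 ''u'')(0 := r)))"
      using t1 s1 ag by (intro expand) (auto simp: agree_def)
    ultimately show "wpt (Seq (set_var ''u'' (var ''r'')) (Seq expand_prog
       (Seq (set_var ''y'' (var ''x'')) (Seq search_prog count_prog)))) (\<lambda>t2 s2. Q (t1 + t2) s2) s1"
      by simp (erule wpt_mono, erule wpt_mono, erule wpt_mono, simp add: Q_def)
  qed
  then show ?thesis by (simp add: try_prog_def Q_def)
qed

section \<open>Tables, and the loops over all roots and bit strings\<close>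

definition setup_prog :: program where
  "setup_prog = Seq
     (For ''v'' (var ''n'') (Assign ''row'' (Plus (var ''v'') (Num 1))
       (Plus (Cell ''row'' (var ''v'')) (var ''n''))))
     (Seq (Assign ''pw'' (Num 0) (Num 1))
       (For ''v'' (Plus (var ''k'') (var ''k'')) (Assign ''pw'' (Plus (var ''v'') (Num 1))
         (Plus (Cell ''pw'' (var ''v'')) (Cell ''pw'' (var ''v''))))))"

lemma assigned_setup_prog [simp]: "assigned setup_prog = {''row'', ''pw'', ''v''}"
  by (auto simp: setup_prog_def)

text \<open>Entry \<open>2 * k\<close> of the table of powers is included because it bounds the loop
  over the bit strings.\<close>

lemma setup_prog_correct:
  assumes n: "s ''n'' 0 = n" and k: "s ''k'' 0 = k" and row: "s ''row'' 0 = 0"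
  shows "wpt setup_prog (\<lambda>t s'. t \<le> 200 * (n + k + 1) \<and> (\<forall>a\<le>n. s' ''row'' a = a * n) \<and>
    (\<forall>i\<le>2 * k. s' ''pw'' i = 2 ^ i)) s"
proof -
  let ?rows = "Assign ''row'' (Plus (var ''v'') (Num 1)) (Plus (Cell ''row'' (var ''v'')) (var ''n''))"
  let ?pws = "Assign ''pw'' (Plus (var ''v'') (Num 1))
    (Plus (Cell ''pw'' (var ''v'')) (Cell ''pw'' (var ''v'')))"
  have rows: "wpt (For ''v'' (var ''n'') ?rows) (\<lambda>t s'. t \<le> n * (expr_cost (var ''n'') + 30 + 10) +
      expr_cost (var ''n'') + 7 \<and> (\<forall>a\<le>n. s' ''row'' a = a * n)) s"
  proof (rule wpt_For[where P = "\<lambda>j s'. \<forall>a\<le>j. s' ''row'' a = a * n"])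
    fix j s' assume "\<forall>a\<le>j. s' ''row'' a = a * n" "s' ''v'' 0 = j"
      and ag: "agree (insert ''v'' (assigned ?rows)) s s'"
    moreover have "s' ''n'' 0 = n" using ag n by (simp add: agree_def)
    ultimately show "wpt ?rows (\<lambda>t s'. t \<le> 30 \<and>
        (\<forall>a\<le>Suc j. (s'(''v'' := (s' ''v'')(0 := Suc j))) ''row'' a = a * n)) s'"
      by (auto simp: le_Suc_eq)
  qed (use n row in \<open>auto simp: agree_def\<close>)
  have pws: "wpt (For ''v'' (Plus (var ''k'') (var ''k'')) ?pws)
      (\<lambda>t s'. t \<le> 2 * k * (expr_cost (Plus (var ''k'') (var ''k'')) + 30 + 10) +
        expr_cost (Plus (var ''k'') (var ''k'')) + 7 \<and> (\<forall>i\<le>2 * k. s' ''pw'' i = 2 ^ i)) s1"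
    if "s1 ''k'' 0 = k" "s1 ''pw'' 0 = 1" for s1
  proof (rule wpt_For[where P = "\<lambda>j s'. \<forall>i\<le>j. s' ''pw'' i = 2 ^ i"])
    fix j s' assume "\<forall>i\<le>j. s' ''pw'' i = 2 ^ i" "s' ''v'' 0 = j"
    then show "wpt ?pws (\<lambda>t s'. t \<le> 30 \<and>
        (\<forall>i\<le>Suc j. (s'(''v'' := (s' ''v'')(0 := Suc j))) ''pw'' i = 2 ^ i)) s'"
      by (auto simp: le_Suc_eq)
  qed (use that in \<open>auto simp: agree_def\<close>)
  show ?thesis
    unfolding setup_prog_def wpt_Seq
  proof (rule wpt_mono[OF rows], elim conjE)
    fix t s1
    assume t: "t \<le> n * (expr_cost (var ''n'') + 30 + 10) + expr_cost (var ''n'') + 7"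
      and row: "\<forall>a\<le>n. s1 ''row'' a = a * n"
      and ag: "agree (assigned (For ''v'' (var ''n'') ?rows)) s s1"
    let ?s = "s1(''pw'' := (s1 ''pw'')(0 := 1))"
    have "?s ''k'' 0 = k" "?s ''pw'' 0 = 1" using ag k by (simp_all add: agree_def)
    then have "wpt (For ''v'' (Plus (var ''k'') (var ''k'')) ?pws) (\<lambda>t2 s2. t + (3 + t2) \<le> 200 * (n + k + 1) \<and>
      (\<forall>a\<le>n. s2 ''row'' a = a * n) \<and> (\<forall>i\<le>2 * k. s2 ''pw'' i = 2 ^ i)) ?s"
      by (rule wpt_mono[OF pws]) (use t row in \<open>auto simp: agree_def\<close>)
    then show "wpt (Assign ''pw'' (Num 0) (Num 1)) (\<lambda>t1 s1. wpt (For ''v'' (Plus (var ''k'') (var ''k'')) ?pws)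
        (\<lambda>t2 s2. t + (t1 + t2) \<le> 200 * (n + k + 1) \<and>
      (\<forall>a\<le>n. s2 ''row'' a = a * n) \<and> (\<forall>i\<le>2 * k. s2 ''pw'' i = 2 ^ i)) s1) s1"
      by (simp add: numeral_eq_Suc)
  qed
qed

definition outer_prog :: program where
  "outer_prog = For ''r'' (var ''n'')
     (For ''x'' (Cell ''pw'' (Plus (var ''k'') (var ''k''))) try_prog)"

lemma assigned_outer_prog [simp]: "assigned outer_prog =
    {''c'', ''cnt'', ''v'', ''last'', ''u'', ''j'', ''y'', ''i'', ''m'', ''out'', ''x'', ''r''}"
  by (auto simp: outer_prog_def)

lemma outer_prog_correct:
  assumes env: "represents s E n" and c: "s ''c'' = (\<lambda>_. 0)" and k: "s ''k'' 0 = k"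
    and pw: "\<forall>i\<le>2 * k. s ''pw'' i = 2 ^ i" and out: "s ''out'' 0 = 0"
  shows "wpt outer_prog (\<lambda>t s'. t \<le> 4000 * (2 ^ (2 * k) * (k + 1) * (n + 1) ^ 3) \<and>
    (s' ''out'' 0 \<noteq> 0 \<longleftrightarrow> (\<exists>r<n. \<exists>x<2 ^ (2 * k). succeeds E n k r x))) s"
proof -
  define z where "z = (n + 1)\<^sup>2 * (k + 1)"
  define p where "p = (2 :: nat) ^ (2 * k)"
  let ?inner = "For ''x'' (Cell ''pw'' (Plus (var ''k'') (var ''k''))) try_prog"
  let ?blank = "\<lambda>s'. \<forall>v\<ge>n. s' ''c'' v = 0"
  let ?W = "insert ''r'' (assigned ?inner)"
  \<comment> \<open>The loop bound is an expression of cost 6, which yields 16 units per round and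
    13 once. The value of \<open>out\<close> is described relative to \<open>s1\<close>, so that the
    roots tried earlier remain accounted for.\<close>
  have inner: "wpt ?inner (\<lambda>t s'. t \<le> p * (2000 * z + 16) + 13 \<and> ?blank s' \<and>
      (s' ''out'' 0 \<noteq> 0 \<longleftrightarrow> s1 ''out'' 0 \<noteq> 0 \<or> (\<exists>x<p. succeeds E n k r x))) s1"
    if s1: "agree ?W s s1" "?blank s1" "s1 ''r'' 0 = r" "r < n" for s1 r
  proof -
    let ?P = "\<lambda>j s'. ?blank s' \<and>
      (s' ''out'' 0 \<noteq> 0 \<longleftrightarrow> s1 ''out'' 0 \<noteq> 0 \<or> (\<exists>x<j. succeeds E n k r x))"
    have "wpt ?inner (\<lambda>t s'. t \<le> p * (expr_cost (Cell ''pw'' (Plus (var ''k'') (var ''k''))) +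
        2000 * z + 10) + expr_cost (Cell ''pw'' (Plus (var ''k'') (var ''k''))) + 7 \<and> ?P p s') s1"
    proof (rule wpt_For[where P = ?P])
      show "?P 0 (s1(''x'' := (s1 ''x'')(0 := 0)))" using s1 by simp
    next
      fix j s' assume "?P j s'" and ag: "agree (insert ''x'' (assigned try_prog)) s1 s'"
      then show "eval_expr (Cell ''pw'' (Plus (var ''k'') (var ''k''))) s' = p"
        using s1(1) pw k by (simp add: agree_def p_def mult_2[symmetric])
    next
      fix j s' assume P: "?P j s'" and x: "s' ''x'' 0 = j"
        and ag: "agree (insert ''x'' (assigned try_prog)) s1 s'"
      have ag': "agree ?W s s'" using s1(1) ag by (simp add: agree_def)
      have "represents s' E n" by (rule represents_agree[OF env ag']) auto
      moreover have "s' ''r'' 0 = r" "s' ''k'' 0 = k" "\<And>i. i < 2 * k \<Longrightarrow> s' ''pw'' i = 2 ^ i"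
        using ag ag' s1(3) k pw by (auto simp: agree_def)
      ultimately show "wpt try_prog (\<lambda>t s'. t \<le> 2000 * z \<and> ?P (Suc j) (s'(''x'' := (s' ''x'')(0 := Suc j)))) s'"
        using P x s1(4) unfolding z_def
        by (intro wpt_mono[OF try_prog_correct[of s' E n r j k]]) (auto simp: less_Suc_eq)
    qed simp
    then show ?thesis by (rule wpt_mono) (auto simp: add.commute)
  qed
  let ?P = "\<lambda>j s'. ?blank s' \<and> (s' ''out'' 0 \<noteq> 0 \<longleftrightarrow> (\<exists>r<j. \<exists>x<p. succeeds E n k r x))"
  have "wpt outer_prog (\<lambda>t s'. t \<le> n * (expr_cost (var ''n'') + (p * (2000 * z + 16) + 13) + 10) +
      expr_cost (var ''n'') + 7 \<and> ?P n s') s"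
    unfolding outer_prog_def
  proof (rule wpt_For[where P = ?P])
    show "?P 0 (s(''r'' := (s ''r'')(0 := 0)))" using c out by simp
  next
    fix j s' assume "?P j s'" and ag: "agree ?W s s'"
    then show "eval_expr (var ''n'') s' = n" using env by (simp add: agree_def represents_def)
  next
    fix j s' assume "j < n" "?P j s'" "agree ?W s s'" "s' ''r'' 0 = j"
    then show "wpt ?inner (\<lambda>t s'. t \<le> p * (2000 * z + 16) + 13 \<and>
        ?P (Suc j) (s'(''r'' := (s' ''r'')(0 := Suc j)))) s'"
      by (intro wpt_mono[OF inner[of s' j]]) (auto simp: less_Suc_eq)
  qed simp
  then show ?thesis
  proof (rule wpt_mono, elim conjE, intro conjI)
    fix t s' assume t: "t \<le> n * (expr_cost (var ''n'') + (p * (2000 * z + 16) + 13) + 10) + expr_cost (var ''n'') + 7"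
    define q where "q = p * z"
    have "1 \<le> p" "1 \<le> z" by (simp_all add: p_def z_def power2_eq_square)
    then have "p \<le> q" "1 \<le> q" by (simp_all add: q_def)
    have "expr_cost (var ''n'') + (p * (2000 * z + 16) + 13) + 10 = 2000 * q + 16 * p + 25"
      by (simp add: q_def algebra_simps)
    also have "\<dots> \<le> 3000 * q" using \<open>p \<le> q\<close> \<open>1 \<le> q\<close> by linarith
    finally have le: "n * (expr_cost (var ''n'') + (p * (2000 * z + 16) + 13) + 10) \<le> n * (3000 * q)"
      by (rule mult_le_mono2)
    have "t \<le> n * (3000 * q) + 9"
      by (rule order_trans[OF t]) (use add_le_mono1[OF le, of 9] in \<open>simp only: expr_cost.simps; simp\<close>)
    also have "\<dots> \<le> 4000 * (q * (n + 1))"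
      using \<open>1 \<le> q\<close> by (simp add: algebra_simps)
    also have "q * (n + 1) = 2 ^ (2 * k) * (k + 1) * (n + 1) ^ 3"
      by (simp only: q_def p_def z_def power2_eq_square power3_eq_cube ac_simps)
    finally show "t \<le> 4000 * (2 ^ (2 * k) * (k + 1) * (n + 1) ^ 3)" .
  qed (simp add: p_def)
qed

text \<open>For positive \<open>k\<close> the guard fails only at \<open>k = 1\<close>. Then a
  single vertex is an out-tree with enough leaves, and \<open>n\<close> is nonzero exactly if there
  is one.\<close>

definition dmlot_prog :: program where
  "dmlot_prog = Cond (Minus (var ''k'') (Num 1)) (Seq setup_prog outer_prog)
     (set_var ''out'' (var ''n''))"

lemma dmlot_prog_correct:
  assumes n: "s ''n'' 0 = n" and k: "s ''k'' 0 = k" "0 < k" and E: "E \<subseteq> {..<n} \<times> {..<n}"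
    and adj: "\<And>a b. a < n \<Longrightarrow> b < n \<Longrightarrow> s ''adj'' (a * n + b) \<noteq> 0 \<longleftrightarrow> (a, b) \<in> E"
    and zero: "s ''row'' 0 = 0" "s ''c'' = (\<lambda>_. 0)" "s ''out'' 0 = 0"
  shows "wpt dmlot_prog (\<lambda>t s'. t \<le> 5000 * (2 ^ (2 * k) * (k + 1) * (n + 1) ^ 3) \<and>
    (s' ''out'' 0 \<noteq> 0 \<longleftrightarrow> k = 1 \<and> n \<noteq> 0 \<or>
      (\<exists>r I. I \<subseteq> {..<n} \<and> rooted E r I \<and> k \<le> card (boundary E I)))) s"
proof -
  define b where "b = 2 ^ (2 * k) * (k + 1) * (n + 1) ^ 3"
  have b: "n + k + 1 \<le> b"
  proof -
    have "(k + 1) * (n + 1) \<le> (2 ^ (2 * k) * (k + 1)) * (n + 1) ^ 3"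
      using mult_le_mono1[of 1 "2 ^ (2 * k)" "k + 1"] self_le_power[of "n + 1" 3]
      by (intro mult_le_mono) auto
    then show ?thesis by (simp add: b_def algebra_simps)
  qed
  have iff: "(\<exists>r<n. \<exists>x<2 ^ (2 * k). succeeds E n k r x) \<longleftrightarrow>
      (\<exists>r I. I \<subseteq> {..<n} \<and> rooted E r I \<and> k \<le> card (boundary E I))"
    using search_iff_rooted[OF E] by (simp add: succeeds_def)
  show ?thesis
  proof (cases "k = 1")
    case True
    have "n \<noteq> 0" if "\<exists>r I. I \<subseteq> {..<n} \<and> rooted E r I \<and> k \<le> card (boundary E I)"
      using that by (auto simp: rooted_def)
    then show ?thesis
      using True k n b unfolding b_def[symmetric] by (auto simp: dmlot_prog_def)
  next
    case False
    have "wpt setup_prog (\<lambda>t1 s1. wpt outer_prog (\<lambda>t2 s2. 20 + (t1 + t2) \<le> 5000 * b \<and>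
      (s2 ''out'' 0 \<noteq> 0 \<longleftrightarrow> (\<exists>r<n. \<exists>x<2 ^ (2 * k). succeeds E n k r x))) s1) s"
    proof (rule wpt_mono[OF setup_prog_correct[of s, OF n k(1) zero(1)]], elim conjE)
      fix t1 s1
      assume t1: "t1 \<le> 200 * (n + k + 1)" and row: "\<forall>a\<le>n. s1 ''row'' a = a * n"
        and pw: "\<forall>i\<le>2 * k. s1 ''pw'' i = 2 ^ i" and ag: "agree (assigned setup_prog) s s1"
      have s1: "represents s1 E n" "s1 ''c'' = (\<lambda>_. 0)" "s1 ''k'' 0 = k" "s1 ''out'' 0 = 0"
        using n E adj row zero k ag by (auto simp: represents_def agree_def)
      show "wpt outer_prog (\<lambda>t2 s2. 20 + (t1 + t2) \<le> 5000 * b \<and>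
          (s2 ''out'' 0 \<noteq> 0 \<longleftrightarrow> (\<exists>r<n. \<exists>x<2 ^ (2 * k). succeeds E n k r x))) s1"
        by (rule wpt_mono[OF outer_prog_correct[of s1, OF s1(1-3) pw s1(4), folded b_def]])
          (use t1 b in auto)
    qed
    then show ?thesis
      using False k unfolding dmlot_prog_def b_def[symmetric] iff
      by simp (erule wpt_mono, erule wpt_mono, simp)
  qed
qed

section \<open>Transfer to the given digraph and the final time bound\<close>

lemma rooted_image:
  assumes E: "E \<subseteq> A \<times> A" and h: "inj_on h A" "\<And>x y. (x, y) \<in> E \<Longrightarrow> (h x, h y) \<in> E'"
    and I: "I \<subseteq> A" "rooted E r I"
    and E': "\<And>x y. x \<in> A \<Longrightarrow> (h x, y) \<in> E' \<Longrightarrow> y \<in> h ` (E `` {x})"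
  shows "rooted E' (h r) (h ` I)" "card (boundary E' (h ` I)) = card (boundary E I)"
proof -
  have "(h r, h x) \<in> (E' \<inter> h ` I \<times> UNIV)\<^sup>*" if "(r, x) \<in> (E \<inter> I \<times> UNIV)\<^sup>*" for x
    using that
  proof (induction rule: rtrancl_induct)
    case (step x y)
    then have "(h x, h y) \<in> E' \<inter> h ` I \<times> UNIV" using h(2) by auto
    then show ?case using step.IH by (rule rtrancl_into_rtrancl[rotated])
  qed simp
  then show "rooted E' (h r) (h ` I)" using I by (auto simp: rooted_def)
  \<comment> \<open>Arcs out of \<open>I\<close> are mapped to arcs, and arcs out of its image lift
    back, so out-neighbourhoods commute with \<open>h\<close>; injectivity then transfers the set
    difference in \<open>boundary\<close>.\<close>
  have "E' `` (h ` I) = h ` (E `` I)" using h(2) E' I(1) by fastforce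
  moreover have "E `` I \<subseteq> A" using E by auto
  ultimately have "boundary E' (h ` I) = h ` boundary E I"
    using inj_on_image_set_diff[OF h(1), of "E `` I" I] I(1) by (auto simp: boundary_def)
  moreover have "boundary E I \<subseteq> A" using E by (auto simp: boundary_def)
  ultimately show "card (boundary E' (h ` I)) = card (boundary E I)"
    using h(1) by (metis card_image inj_on_subset)
qed

text \<open>\<open>rooted_image\<close> carries solutions in one direction, so it is applied to the
  enumeration and to its inverse.\<close>

lemma rooted_enumeration:
  assumes vs: "distinct vs" "set vs = pverts D" and "pair_digraph D"
  defines "n \<equiv> length vs"
  defines "E \<equiv> {(a, b). a < n \<and> b < n \<and> (vs ! a, vs ! b) \<in> parcs D}"
  shows "(\<exists>r I. I \<subseteq> {..<n} \<and> rooted E r I \<and> k \<le> card (boundary E I)) \<longleftrightarrow>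
    (\<exists>r I. I \<subseteq> pverts D \<and> rooted (parcs D) r I \<and> k \<le> card (boundary (parcs D) I))"
proof
  interpret pair_digraph D by fact
  let ?h = "(!) vs"
  let ?g = "the_inv_into {..<n} ?h"
  have bij: "bij_betw ?h {..<n} (pverts D)"
    using bij_betw_nth[OF vs(1) refl] vs(2) by (simp add: n_def)
  then have inj: "inj_on ?h {..<n}" by (simp add: bij_betw_def)
  have gbij: "bij_betw ?g (pverts D) {..<n}" using bij by (rule bij_betw_the_inv_into)
  have hg: "?h (?g v) = v" "?g v < n" if "v \<in> pverts D" for v
    using f_the_inv_into_f_bij_betw[OF bij] bij_betwE[OF gbij] that by auto
  have gh: "?g (?h a) = a" "?h a \<in> pverts D" if "a < n" for a
    using the_inv_into_f_f[OF inj] bij_betwE[OF bij] that by auto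
  have arc: "x \<in> pverts D" "y \<in> pverts D" if "(x, y) \<in> parcs D" for x y
    using that in_arcsD1 in_arcsD2 by auto
  {
    assume "\<exists>r I. I \<subseteq> {..<n} \<and> rooted E r I \<and> k \<le> card (boundary E I)"
    then obtain r I where I: "I \<subseteq> {..<n}" "rooted E r I" "k \<le> card (boundary E I)" by blast
    have E: "E \<subseteq> {..<n} \<times> {..<n}" by (auto simp: E_def)
    have hom: "(?h x, ?h y) \<in> parcs D" if "(x, y) \<in> E" for x y
      using that by (simp add: E_def)
    have surj: "y \<in> ?h ` (E `` {x})" if "x \<in> {..<n}" "(?h x, y) \<in> parcs D" for x y
    proof -
      have "(x, ?g y) \<in> E" "y = ?h (?g y)"
        using that arc hg by (auto simp: E_def)
      then show ?thesis by blast
    qed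
    note rooted_image[OF E inj hom I(1,2) surj]
    moreover have "?h ` I \<subseteq> pverts D" using I gh by auto
    ultimately show "\<exists>r I. I \<subseteq> pverts D \<and> rooted (parcs D) r I \<and> k \<le> card (boundary (parcs D) I)"
      using I(3) by metis
  next
    assume "\<exists>r I. I \<subseteq> pverts D \<and> rooted (parcs D) r I \<and> k \<le> card (boundary (parcs D) I)"
    then obtain r I where I: "I \<subseteq> pverts D" "rooted (parcs D) r I"
      "k \<le> card (boundary (parcs D) I)" by blast
    have sub: "parcs D \<subseteq> pverts D \<times> pverts D" using arc by auto
    have hom: "(?g x, ?g y) \<in> E" if "(x, y) \<in> parcs D" for x y
      using that arc[OF that] hg by (simp add: E_def)
    have surj: "y \<in> ?g ` (parcs D `` {x})" if "x \<in> pverts D" "(?g x, y) \<in> E" for x y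
    proof -
      have "(x, ?h y) \<in> parcs D" "y = ?g (?h y)"
        using that hg gh by (auto simp: E_def)
      then show ?thesis by blast
    qed
    note rooted_image[OF sub bij_betw_imp_inj_on[OF gbij] hom I(1,2) surj]
    moreover have "?g ` I \<subseteq> {..<n}" using I hg by auto
    ultimately show "\<exists>r I. I \<subseteq> {..<n} \<and> rooted E r I \<and> k \<le> card (boundary E I)"
      using I(3) by metis
  }
qed

lemma dmlot_prog_decides:
  assumes "pair_digraph D" "0 < k"
  shows "decides_dmlot_within dmlot_prog D k
    (2 powr (3 * real k + 16) * real (max 1 (card (pverts D))) ^ 3)"
  unfolding decides_dmlot_within_def
proof (intro allI impI, elim conjE)
  fix vs assume vs: "distinct vs" "set vs = pverts D"
  define n where "n = length vs"
  define E where "E = {(a, b). a < n \<and> b < n \<and> (vs ! a, vs ! b) \<in> parcs D}"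
  let ?s = "dmlot_input D vs k"
  have card: "card (pverts D) = n" using vs distinct_card n_def by metis
  have adj: "?s ''adj'' (a * n + b) \<noteq> 0 \<longleftrightarrow> (a, b) \<in> E" if ab: "a < n" "b < n" for a b
  proof -
    \<comment> \<open>The input describes a cell by some pair with this index; division with
      remainder by \<open>n\<close> shows that the pair is unique.\<close>
    have "a = a' \<and> b = b'" if "a * n + b = a' * n + b'" "b' < n" for a' b'
    proof -
      have "(a * n + b) div n = a" "(a * n + b) mod n = b" using ab by auto
      moreover have "(a' * n + b') div n = a'" "(a' * n + b') mod n = b'" using that by auto
      ultimately show ?thesis using that(1) by metis
    qed
    then show ?thesis using ab unfolding dmlot_input_def E_def n_def by auto
  qed
  have "wpt dmlot_prog (\<lambda>t s'. t \<le> 5000 * (2 ^ (2 * k) * (k + 1) * (n + 1) ^ 3) \<and>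
    (s' ''out'' 0 \<noteq> 0 \<longleftrightarrow> k = 1 \<and> n \<noteq> 0 \<or>
      (\<exists>r I. I \<subseteq> {..<n} \<and> rooted E r I \<and> k \<le> card (boundary E I)))) ?s"
  proof (rule dmlot_prog_correct)
    show "E \<subseteq> {..<n} \<times> {..<n}" by (auto simp: E_def)
  qed (use adj assms(2) in \<open>auto simp: dmlot_input_def n_def\<close>)
  then obtain t s' where ex: "exec dmlot_prog ?s t s'"
    and t: "t \<le> 5000 * (2 ^ (2 * k) * (k + 1) * (n + 1) ^ 3)"
    and out: "s' ''out'' 0 \<noteq> 0 \<longleftrightarrow> k = 1 \<and> n \<noteq> 0 \<or>
      (\<exists>r I. I \<subseteq> {..<n} \<and> rooted E r I \<and> k \<le> card (boundary E I))"
    unfolding wpt_def by blast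
  have "n \<noteq> 0 \<longleftrightarrow> pverts D \<noteq> {}" using vs n_def by auto
  then have "s' ''out'' 0 \<noteq> 0 \<longleftrightarrow> has_out_tree_with_leaves (with_proj D) k"
    using out has_out_tree_iff_rooted[OF assms] rooted_enumeration[OF vs assms(1), of k]
    unfolding E_def n_def by simp
  moreover have "real t \<le> 2 powr (3 * real k + 16) * real (max 1 (card (pverts D))) ^ 3"
  proof -
    define N where "N = max 1 n"
    \<comment> \<open>Absorbing \<open>k + 1\<close> into \<open>2 ^ k\<close> raises the exponent
      from \<open>2 * k\<close> to \<open>3 * k\<close>. Replacing \<open>n + 1\<close> by
      \<open>2 * N\<close> costs a factor 8, and \<open>5000 * 8 = 40000\<close> is below
      \<open>2 ^ 16\<close>.\<close>
    have "k + 1 \<le> 2 ^ k" by (induction k) auto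
    moreover have "(n + 1) ^ 3 \<le> (2 * N) ^ 3" by (intro power_mono) (auto simp: N_def)
    ultimately have "2 ^ (2 * k) * (k + 1) * (n + 1) ^ 3 \<le> 2 ^ (2 * k) * 2 ^ k * (2 * N) ^ 3"
      by (intro mult_mono) auto
    then have "t \<le> 5000 * (2 ^ (2 * k) * 2 ^ k * (2 * N) ^ 3)" using t by linarith
    also have "\<dots> = 40000 * 2 ^ (3 * k) * N ^ 3"
      by (simp add: power_mult_distrib power_add[symmetric])
    also have "\<dots> \<le> 2 ^ 16 * 2 ^ (3 * k) * N ^ 3" by simp
    also have "\<dots> = 2 ^ (3 * k + 16) * N ^ 3" by (simp add: power_add)
    finally have "real t \<le> real (2 ^ (3 * k + 16) * N ^ 3)"
      by (simp only: of_nat_le_iff)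
    also have "\<dots> = 2 ^ (3 * k + 16) * real N ^ 3" by simp
    also have "(2 :: real) ^ (3 * k + 16) = 2 powr (3 * real k + 16)"
      using powr_realpow[of 2 "3 * k + 16"] by simp
    finally show ?thesis by (simp add: N_def card)
  qed
  ultimately show "\<exists>t s'. exec dmlot_prog ?s t s' \<and>
      real t \<le> 2 powr (3 * real k + 16) * real (max 1 (card (pverts D))) ^ 3 \<and>
      (s' ''out'' 0 \<noteq> 0 \<longleftrightarrow> has_out_tree_with_leaves (with_proj D) k)"
    using ex by blast
qed

theorem mainTheorem7:
  shows "(\<exists>c :: program. \<exists>f :: nat \<Rightarrow> real. \<exists>d :: nat.
            f \<in> O(\<lambda>k. real k * (log 2 (real k))\<^sup>2) \<and>
            (\<forall>(D :: nat pair_pre_digraph) (k :: nat). pair_digraph D \<and> 0 < k \<longrightarrow>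
               decides_dmlot_within c D k
                 (2 powr f k * real (max 1 (card (pverts D))) ^ d)))
       \<and> (\<exists>c :: program. \<exists>f :: nat \<Rightarrow> real. \<exists>d :: nat.
            f \<in> O(\<lambda>k. real k * log 2 (real k)) \<and>
            (\<forall>(D :: nat pair_pre_digraph) (k :: nat). pair_digraph D \<and> 0 < k \<and>
               acyclic_digraph (with_proj D) \<longrightarrow>
               decides_dmlot_within c D k
                 (2 powr f k * real (max 1 (card (pverts D))) ^ d)))"
proof -
  \<comment> \<open>The logarithm vanishes at \<open>k = 1\<close>, but it is at least 1 from
    \<open>k = 2\<close> on, so both functions dominate a linear one for large
    \<open>k\<close>.\<close>
  have "(\<lambda>k. 3 * real k + 16) \<in> O(\<lambda>k. real k * (log 2 (real k))\<^sup>2)" by real_asymp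
  moreover have "(\<lambda>k. 3 * real k + 16) \<in> O(\<lambda>k. real k * log 2 (real k))" by real_asymp
  ultimately show ?thesis using dmlot_prog_decides by blast
qed

end
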